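(* Let $\beta=\omega^\gamma\ge\varepsilon_0$ be an ordinal equipped with a norm $N:\beta\to\mathbb N$ which makes $\beta$ an additive number system with set of primes $\{\omega^\alpha:\alpha<\gamma\}$ and which extends the standard norm on the ordinals below $\varepsilon_0$. Let $c_\beta(n)=\#\{\alpha<\beta:N(\alpha)=n\}$ and assume that $c_\beta(n)\in RT_\rho$ for some $\rho<1$. Then $\beta$ satisfies a monadic second order limit law: for every monadic second order sentence $\varphi$ in the language of linear orders, the limit $$\lim_{n\to\infty}\frac{\#\{\alpha<\beta:\ \alpha\models\varphi,\ N(\alpha)=n\}}{c_\beta(n)}$$ exists.
   Context: $\varepsilon_0$ is the least ordinal $\xi$ with $\xi=\omega^\xi$. The standard norm below $\varepsilon_0$ is defined recursively by $N(0)=0$ and $N(\alpha)=n+N(\alpha_1)+\cdots+N(\alpha_n)$ if $\alpha=\omega^{\alpha_1}+\cdots+\omega^{\alpha_n}$ with $\alpha_1\ge\cdots\ge\alpha_n$. That $\beta=\omega^\gamma$ is an additive number system with primes $\{\omega^\alpha:\alpha<\gamma\}$ under $N$ means: with the natural (Hessenberg) sum as addition, $N(0)=0$, $N(\omega^\alpha)\ge1$ for all $\alpha<\gamma$, $N(\omega^{\alpha_1}+\cdots+\omega^{\alpha_n})=N(\omega^{\alpha_1})+\cdots+N(\omega^{\alpha_n})$ whenever $\gamma>\alpha_1\ge\cdots\ge\alpha_n$, and $c_\beta(n)$ is finite for every $n$. $c_\beta(n)\in RT_\rho$ means $\lim_{n\to\infty}c_\beta(n)/c_\beta(n+1)=\rho$.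 The monadic second order language of linear orders has a single relation symbol $<$ (no constants, no function symbols); $\alpha\models\varphi$ means that the structure $\langle\alpha,<\rangle$, where $\alpha$ is identified with the set of smaller ordinals, satisfies $\varphi$, set variables ranging over all subsets of $\alpha$. *)

theory Defs
  imports Complex_Main "HOL-Library.Infinite_Typeclass"
begin

section \<open>Ordinals\<close>

text \<open>
  An ordinal is the isomorphism class of a well-order on a subset of a fixed type. The members of
  the type below are the ordinals of cardinality at most that of the carrier type; as
  the carrier type is a free type variable, every ordinal is covered.
\<close>

quotient_type 'a ordinal = "'a rel" / partial: "\<lambda>r s. (r, s) \<in> (ordIso :: ('a rel \<times> 'a rel) set)"
proof (rule part_equivpI)
  show "\<exists>r. (r, r) \<in> (ordIso :: ('a rel \<times> 'a rel) set)"
    using ordIso_reflexive card_of_Well_order by blast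
  show "symp (\<lambda>r s. (r, s) \<in> (ordIso :: ('a rel \<times> 'a rel) set))"
    by (auto intro!: sympI ordIso_symmetric)
  show "transp (\<lambda>r s. (r, s) \<in> (ordIso :: ('a rel \<times> 'a rel) set))"
    by (auto intro!: transpI elim: ordIso_transitive)
qed

lemma ordLeq_cong:
  assumes "(r, r') \<in> ordIso" "(s, s') \<in> ordIso"
  shows "(r, s) \<in> ordLeq \<longleftrightarrow> (r', s') \<in> ordLeq"
proof
  show "(r, s) \<in> ordLeq \<Longrightarrow> (r', s') \<in> ordLeq"
    using assms by (meson ordIso_symmetric ordIso_ordLeq_trans ordLeq_ordIso_trans)
  show "(r', s') \<in> ordLeq \<Longrightarrow> (r, s) \<in> ordLeq"
    using assms by (meson ordIso_symmetric ordIso_ordLeq_trans ordLeq_ordIso_trans)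
qed

lemma ordLess_cong:
  assumes "(r, r') \<in> ordIso" "(s, s') \<in> ordIso"
  shows "(r, s) \<in> ordLess \<longleftrightarrow> (r', s') \<in> ordLess"
proof
  show "(r, s) \<in> ordLess \<Longrightarrow> (r', s') \<in> ordLess"
    using assms by (meson ordIso_symmetric ordIso_ordLess_trans ordLess_ordIso_trans)
  show "(r', s') \<in> ordLess \<Longrightarrow> (r, s) \<in> ordLess"
    using assms by (meson ordIso_symmetric ordIso_ordLess_trans ordLess_ordIso_trans)
qed

instantiation ordinal :: (type) wellorder
begin

lift_definition less_eq_ordinal :: "'a ordinal \<Rightarrow> 'a ordinal \<Rightarrow> bool"
  is "\<lambda>r s. (r, s) \<in> ordLeq"
  by (rule ordLeq_cong)

lift_definition less_ordinal :: "'a ordinal \<Rightarrow> 'a ordinal \<Rightarrow> bool"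
  is "\<lambda>r s. (r, s) \<in> ordLess"
  by (rule ordLess_cong)

instance
proof
  fix x y z :: "'a ordinal"
  show "(x < y) = (x \<le> y \<and> \<not> y \<le> x)"
    by transfer (auto simp: ordIso_def not_ordLeq_iff_ordLess intro: ordLess_imp_ordLeq)
  show "x \<le> x"
    by transfer (simp add: ordIso_imp_ordLeq)
  show "x \<le> y \<Longrightarrow> y \<le> z \<Longrightarrow> x \<le> z"
    by transfer (rule ordLeq_transitive)
  show "x \<le> y \<Longrightarrow> y \<le> x \<Longrightarrow> x = y"
    by transfer (simp add: ordIso_iff_ordLeq)
  show "x \<le> y \<or> y \<le> x"
    by transfer (use ordLeq_total in \<open>auto simp: ordIso_def\<close>)
  fix P :: "'a ordinal \<Rightarrow> bool" and a
  assume step: "\<And>x. (\<And>y. y < x \<Longrightarrow> P y) \<Longrightarrow> P x"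
  have "wf (inv_image (ordLess :: ('a rel \<times> 'a rel) set) rep_ordinal)"
    by (rule wf_inv_image) (rule wf_ordLess)
  moreover have "{(x, y). x < y} \<subseteq> inv_image (ordLess :: ('a rel \<times> 'a rel) set) rep_ordinal"
    by (auto simp: less_ordinal_def)
  ultimately have "wf {(x, y :: 'a ordinal). x < y}"
    by (rule wf_subset)
  then show "P a"
    by (rule wf_induct_rule) (use step in auto)
qed

end

text \<open>
  For an infinite carrier type, the ordinals above are closed under successor, addition,
  multiplication and exponentiation, and every set of ordinals indexed by the predecessors of an
  ordinal is bounded. So the least elements and suprema used below exist.
\<close>

definition ord_sup :: "'a::infinite ordinal set \<Rightarrow> 'a ordinal" where
  "ord_sup S = (LEAST x. \<forall>y\<in>S. y \<le> x)"

definition ord_succ :: "'a::infinite ordinal \<Rightarrow> 'a ordinal" where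
  "ord_succ a = (LEAST x. a < x)"

instantiation ordinal :: (infinite) "{zero, one, plus, times}"
begin

definition zero_ordinal :: "'a ordinal" where
  "0 = (LEAST x :: 'a ordinal. True)"

definition one_ordinal :: "'a ordinal" where
  "1 = ord_succ (0 :: 'a ordinal)"

function plus_ordinal :: "'a ordinal \<Rightarrow> 'a ordinal \<Rightarrow> 'a ordinal" where
  "a + b = ord_sup (insert a ((\<lambda>b'. ord_succ (a + b')) ` {..<b}))"
  by pat_completeness auto
termination
  by (relation "inv_image {(x, y). x < y} snd") (auto simp: wf)

declare plus_ordinal.simps [simp del]

function times_ordinal :: "'a ordinal \<Rightarrow> 'a ordinal \<Rightarrow> 'a ordinal" where
  "a * b = ord_sup ((\<lambda>b'. a * b' + a) ` {..<b})"
  by pat_completeness auto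
termination
  by (relation "inv_image {(x, y). x < y} snd") (auto simp: wf)

declare times_ordinal.simps [simp del]

instance ..

end

text \<open>The usual ordinal power for a base \<open>a \<ge> 1\<close>; only base \<open>\<omega>\<close> is used.\<close>

function ord_power :: "'a::infinite ordinal \<Rightarrow> 'a ordinal \<Rightarrow> 'a ordinal" where
  "ord_power a b = ord_sup (insert 1 ((\<lambda>b'. ord_power a b' * a) ` {..<b}))"
  by pat_completeness auto
termination
  by (relation "inv_image {(x, y). x < y} snd") (auto simp: wf)

declare ord_power.simps [simp del]

definition omega :: "'a::infinite ordinal" where
  "omega = (LEAST x. 0 < x \<and> (\<forall>y<x. ord_succ y < x))"

abbreviation omega_pow :: "'a::infinite ordinal \<Rightarrow> 'a ordinal" where
  "omega_pow a \<equiv> ord_power omega a"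

definition epsilon0 :: "'a::infinite ordinal" where
  "epsilon0 = (LEAST x. x = omega_pow x)"

section \<open>Cantor normal form, natural sum and norms\<close>

definition omega_sum :: "'a::infinite ordinal list \<Rightarrow> 'a ordinal" where
  "omega_sum as = foldr (\<lambda>a s. omega_pow a + s) as 0"

definition nonincreasing :: "'a::linorder list \<Rightarrow> bool" where
  "nonincreasing as \<longleftrightarrow> sorted_wrt (\<ge>) as"

definition cnf :: "'a::infinite ordinal \<Rightarrow> 'a ordinal list" where
  "cnf a = (THE as. nonincreasing as \<and> a = omega_sum as)"

text \<open>Hessenberg's sum: merge the exponents of both Cantor normal forms.\<close>

definition natural_sum :: "'a::infinite ordinal \<Rightarrow> 'a ordinal \<Rightarrow> 'a ordinal" (infixl "\<oplus>" 65) where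
  "a \<oplus> b = omega_sum (rev (sort (cnf a @ cnf b)))"

text \<open>
  \<open>standard_norm \<alpha> m\<close> is the graph of the standard norm; it is derivable for exactly the ordinals
  below \<open>\<epsilon>\<^sub>0\<close>, and for a unique \<open>m\<close> each. The empty list gives the value \<open>0\<close> at \<open>0\<close>.
\<close>

inductive standard_norm :: "'a::infinite ordinal \<Rightarrow> nat \<Rightarrow> bool" where
  "\<lbrakk>nonincreasing as; list_all2 standard_norm as ms\<rbrakk>
    \<Longrightarrow> standard_norm (omega_sum as) (length as + sum_list ms)"

definition extends_standard_norm :: "('a::infinite ordinal \<Rightarrow> nat) \<Rightarrow> bool" where
  "extends_standard_norm N \<longleftrightarrow> (\<forall>a<epsilon0. standard_norm a (N a))"

definition norm_count :: "('a::infinite ordinal \<Rightarrow> nat) \<Rightarrow> 'a ordinal \<Rightarrow> nat \<Rightarrow> nat" where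
  "norm_count N \<beta> n = card {a. a < \<beta> \<and> N a = n}"

text \<open>
  \<open>N\<close> makes \<open>\<omega>\<^sup>\<gamma>\<close> an additive number system with primes \<open>\<omega>\<^sup>\<alpha>\<close>, \<open>\<alpha> < \<gamma>\<close>. Values of \<open>N\<close> outside
  \<open>\<omega>\<^sup>\<gamma>\<close> are irrelevant.
\<close>

definition additive_number_system ::
    "'a::infinite ordinal \<Rightarrow> ('a ordinal \<Rightarrow> nat) \<Rightarrow> bool" where
  "additive_number_system \<gamma> N \<longleftrightarrow>
     N 0 = 0 \<and>
     (\<forall>a<\<gamma>. N (omega_pow a) \<ge> 1) \<and>
     (\<forall>as. nonincreasing as \<and> (\<forall>a\<in>set as. a < \<gamma>) \<longrightarrow>
        N (foldr (\<oplus>) (map omega_pow as) 0) = sum_list (map (\<lambda>a. N (omega_pow a)) as)) \<and>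
     (\<forall>n. finite {a. a < omega_pow \<gamma> \<and> N a = n})"

definition RT :: "real \<Rightarrow> (nat \<Rightarrow> nat) \<Rightarrow> bool" where
  "RT \<rho> c \<longleftrightarrow> (\<lambda>n. real (c n) / real (c (n + 1))) \<longlonglongrightarrow> \<rho>"

section \<open>Monadic second order logic of linear orders\<close>

text \<open>
  Element variables and set variables are two separate families, each indexed by \<open>nat\<close>. Equality is
  a logical symbol; the remaining connectives and universal quantifiers are the usual abbreviations.
\<close>

datatype mso =
    Eq nat nat
  | Less nat nat
  | Mem nat nat \<comment> \<open>element variable, set variable\<close>
  | Neg mso
  | Conj mso mso
  | ExElem nat mso
  | ExSet nat mso

primrec free_elem :: "mso \<Rightarrow> nat set" where
  "free_elem (Eq i j) = {i, j}"
| "free_elem (Less i j) = {i, j}"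
| "free_elem (Mem i j) = {i}"
| "free_elem (Neg f) = free_elem f"
| "free_elem (Conj f g) = free_elem f \<union> free_elem g"
| "free_elem (ExElem i f) = free_elem f - {i}"
| "free_elem (ExSet i f) = free_elem f"

primrec free_set :: "mso \<Rightarrow> nat set" where
  "free_set (Eq i j) = {}"
| "free_set (Less i j) = {}"
| "free_set (Mem i j) = {j}"
| "free_set (Neg f) = free_set f"
| "free_set (Conj f g) = free_set f \<union> free_set g"
| "free_set (ExElem i f) = free_set f"
| "free_set (ExSet i f) = free_set f - {i}"

definition sentence :: "mso \<Rightarrow> bool" where
  "sentence f \<longleftrightarrow> free_elem f = {} \<and> free_set f = {}"

primrec sat :: "'b::linorder set \<Rightarrow> (nat \<Rightarrow> 'b) \<Rightarrow> (nat \<Rightarrow> 'b set) \<Rightarrow> mso \<Rightarrow> bool" where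
  "sat A u U (Eq i j) \<longleftrightarrow> u i = u j"
| "sat A u U (Less i j) \<longleftrightarrow> u i < u j"
| "sat A u U (Mem i j) \<longleftrightarrow> u i \<in> U j"
| "sat A u U (Neg f) \<longleftrightarrow> \<not> sat A u U f"
| "sat A u U (Conj f g) \<longleftrightarrow> sat A u U f \<and> sat A u U g"
| "sat A u U (ExElem i f) \<longleftrightarrow> (\<exists>x\<in>A. sat A (u(i := x)) U f)"
| "sat A u U (ExSet i f) \<longleftrightarrow> (\<exists>X. X \<subseteq> A \<and> sat A u (U(i := X)) f)"

text \<open>Meaningful for sentences only, whose truth does not depend on the assignment chosen here.\<close>

definition models :: "'a ordinal \<Rightarrow> mso \<Rightarrow> bool" (infix "\<Turnstile>" 50) where
  "\<alpha> \<Turnstile> f \<longleftrightarrow> sat {..<\<alpha>} (\<lambda>_. undefined) (\<lambda>_. {}) f"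

definition mso_limit_law :: "'a::infinite ordinal \<Rightarrow> ('a ordinal \<Rightarrow> nat) \<Rightarrow> bool" where
  "mso_limit_law \<beta> N \<longleftrightarrow>
     (\<forall>f. sentence f \<longrightarrow>
        (\<exists>l. (\<lambda>n. real (card {a. a < \<beta> \<and> a \<Turnstile> f \<and> N a = n}) / real (norm_count N \<beta> n))
               \<longlonglongrightarrow> l))"

end

theory Submission
  imports Defs "HOL-Library.Multiset" "HOL-Library.Countable_Set" "HOL-Analysis.Uniform_Limit"
begin

text \<open>
  By Ehrenfeucht-Fraisse games, the monadic theory of an ordered sum up to a fixed quantifier depth
  depends only on the theories of the summands. There are finitely many such theories, and an
  absorption argument shows that all countable powers \<open>\<omega>\<^sup>c\<close> with \<open>c \<ge> p\<close> are equivalent for some finite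
  \<open>p\<close>, and so are all finite sums of such powers. Since the norm has finite fibres, every ordinal
  below \<open>\<beta>\<close> is countable. Hence the truth of a sentence in \<open>\<alpha> < \<beta>\<close> depends only on the terms
  \<open>\<omega>\<^sup>a\<close>, \<open>a < p\<close>, of its Cantor normal form, once \<open>\<alpha>\<close> has a term of exponent \<open>\<ge> p\<close>. Splitting
  \<open>c\<^sub>\<beta>(n)\<close> by the norm \<open>j\<close> of this low part gives a sum of polynomially many low parts times
  \<open>h(n - j)\<close>, where \<open>h(n - j) / c\<^sub>\<beta>(n)\<close> tends to \<open>K \<rho>\<^sup>j\<close> and is bounded by \<open>C r\<^sup>j\<close> for some \<open>r < 1\<close>;
  dominated convergence yields the limit.
\<close>

section \<open>Ordinal arithmetic\<close>

text \<open>Countability is what allows a single class of large powers. The exponents below a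
  countable \<open>c\<close> can be listed in a sequence, so \<open>omega_pow c\<close> is a sum of
  length \<open>omega\<close> of smaller powers; monadic logic can tell cofinality
  \<open>omega\<close> from uncountable cofinality. The threshold \<open>p\<close> is finite so that
  only finitely many primes are low. Removing a low prime of norm \<open>w\<close> multiplies the
  counting function asymptotically by \<open>1 - \<rho>^w\<close>, and the product of these factors
  is the constant \<open>K\<close>. The bound \<open>\<rho> < 1\<close> gives the geometric decay
  that beats the polynomial number of low parts; it also makes the ordinals without high term
  negligible. Extending the standard norm gives \<open>N 1 = 1\<close>, so \<open>n\<close> copies
  of \<open>1\<close> form an ordinal of norm \<open>n\<close> and no quotient has denominator zero.
  A foundational obstacle is that the ordinal operations are defined by least elements, which mean
  something only if witnesses exist. Hence the need to show that no set of the size of the carrier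
  is cofinal in the ordinals.\<close>

lemma abs_ordinal_less_iff:
  assumes "Well_order r" "Well_order s"
  shows "abs_ordinal r < abs_ordinal s \<longleftrightarrow> (r, s) \<in> ordLess"
  using assms by (auto intro!: less_ordinal.abs_eq ordIso_reflexive)

section \<open>Size of the type of ordinals and boundedness of small sets\<close>

lemma Well_order_rep_ordinal: "Well_order (rep_ordinal x)"
proof -
  have "(rep_ordinal x, rep_ordinal x) \<in> ordIso"
    by (rule Quotient3_rep_reflp[OF Quotient3_ordinal])
  then show ?thesis
    by (simp add: ordIso_def)
qed

lemma rep_ordinal_ordIso_imp_eq:
  assumes "(rep_ordinal x, rep_ordinal y) \<in> ordIso"
  shows "x = y"
  using assms by (simp add: Quotient3_rel_rep[OF Quotient3_ordinal])

text \<open>Each \<open>y < x\<close> is isomorphic to the initial segment of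
  \<open>rep_ordinal x\<close> below some point \<open>g y\<close> of the carrier, and that point
  determines \<open>y\<close>.\<close>

lemma card_lessThan_ordinal: "(card_of ({..<x :: 'a ordinal}), card_of (UNIV :: 'a set)) \<in> ordLeq"
proof -
  let ?r = "rep_ordinal x"
  have "\<exists>a. (rep_ordinal y, Restr ?r (underS ?r a)) \<in> ordIso" if "y < x" for y
  proof -
    have "(rep_ordinal y, ?r) \<in> ordLess"
      using that by (auto simp: less_ordinal_def)
    then show ?thesis
      by (auto simp: ordLess_iff_ordIso_Restr[OF Well_order_rep_ordinal Well_order_rep_ordinal])
  qed
  then obtain g where g: "\<And>y. y < x \<Longrightarrow> (rep_ordinal y, Restr ?r (underS ?r (g y))) \<in> ordIso"
    by metis
  have "inj_on g {..<x}"
  proof (rule inj_onI)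
    fix y z assume "y \<in> {..<x}" "z \<in> {..<x}" and eq: "g y = g z"
    then have "y < x" "z < x" by auto
    from ordIso_transitive[OF g[OF this(1)] ordIso_symmetric[OF g[OF this(2), folded eq]]]
    show "y = z"
      by (rule rep_ordinal_ordIso_imp_eq)
  qed
  then show ?thesis
    using card_of_ordLeq[of "{..<x}" "UNIV :: 'a set"] by auto
qed

lemma strict_mono_le_wellorder:
  fixes h :: "'b::wellorder \<Rightarrow> 'b"
  assumes "\<And>x y. x < y \<Longrightarrow> h x < h y"
  shows "x \<le> h x"
proof (induction x rule: less_induct)
  case (less x)
  show ?case
  proof (rule ccontr)
    assume "\<not> x \<le> h x"
    then have "h x < x" by simp
    with less.IH[OF this] assms[OF this] show False by simp
  qed
qed

lemma Well_order_le: "Well_order {(x, y). x \<le> (y :: 'b::wellorder)}"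
proof -
  have "wf ({(x, y). x \<le> (y :: 'b)} - Id)"
    by (rule wf_subset[OF wf]) auto
  then show ?thesis
    by (auto simp: well_order_on_def linear_order_on_def partial_order_on_def preorder_on_def
        refl_on_def trans_def antisym_def total_on_def Field_def)
qed

text \<open>
  The Burali-Forti argument: an embedding of the ordinals into the carrier would induce a well-order
  on the carrier whose proper initial segments already realise all ordinals.
\<close>

lemma card_UNIV_ordinal: "(card_of (UNIV :: 'a ordinal set), card_of (UNIV :: 'a set)) \<notin> ordLeq"
proof
  assume "(card_of (UNIV :: 'a ordinal set), card_of (UNIV :: 'a set)) \<in> ordLeq"
  then obtain f :: "'a ordinal \<Rightarrow> 'a" where f: "inj f"
    using card_of_ordLeq[of "UNIV :: 'a ordinal set" "UNIV :: 'a set"] by auto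
  define R where "R = {(x, y). x \<le> (y :: 'a ordinal)}"
  define r where "r = dir_image R f"
  have fieldR: "Field R = UNIV"
    by (auto simp: R_def Field_def)
  have W: "Well_order r"
    unfolding r_def using Well_order_le f fieldR R_def by (metis Well_order_dir_image)
  have fieldr: "Field r = range f"
    by (simp add: r_def dir_image_Field fieldR)
  define h where "h x = abs_ordinal (Restr r (underS r (f x)))" for x
  have of: "wo_rel.ofilter r (underS r a)" for a
    using W wo_rel.underS_ofilter[of r a] by (simp add: wo_rel_def)
  have WR: "Well_order (Restr r A)" for A
    using W by (rule Well_order_Restr)
  have "h x < h y" if "x < y" for x y
  proof -
    have "(f x, f y) \<in> r" "f x \<noteq> f y"
      using that f by (auto simp: r_def dir_image_def R_def inj_eq)
    then have "underS r (f x) \<subset> underS r (f y)"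
      using W unfolding underS_def
      by (auto simp: well_order_on_def linear_order_on_def partial_order_on_def preorder_on_def
          trans_def antisym_def)
    then have "(Restr r (underS r (f x)), Restr r (underS r (f y))) \<in> ordLess"
      by (simp add: ofilter_subset_ordLess[OF W of of])
    then show ?thesis
      by (simp add: h_def abs_ordinal_less_iff[OF WR WR])
  qed
  then have "x \<le> h x" for x
    by (rule strict_mono_le_wellorder)
  moreover have "h x < abs_ordinal r" for x
  proof -
    have "(Restr r (underS r (f x)), r) \<in> ordLess"
      using ordIso_reflexive[OF WR] by (auto simp: ordLess_iff_ordIso_Restr[OF W WR] fieldr)
    then show ?thesis
      by (simp add: h_def abs_ordinal_less_iff[OF WR W])
  qed
  ultimately show False
    using leD by blast
qed

text \<open>A cofinal set of this size would cover all ordinals by carrier-many initial segments,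
  each no larger than the infinite carrier, against Burali-Forti. This supplies the witnesses for
  the suprema and least elements in the definitions.\<close>

lemma small_set_bounded:
  fixes S :: "'a::infinite ordinal set"
  assumes "(card_of S, card_of (UNIV :: 'a set)) \<in> ordLeq"
  shows "\<exists>x. \<forall>y\<in>S. y < x"
proof (rule ccontr)
  assume "\<nexists>x. \<forall>y\<in>S. y < x"
  then have "UNIV = (\<Union>y\<in>S. {..<y} \<union> {y})"
    by (force simp: not_less le_less)
  moreover have "(card_of ({..<y} \<union> {y}), card_of (UNIV :: 'a set)) \<in> ordLeq" for y :: "'a ordinal"
    by (rule card_of_Un_ordLeq_infinite_Field)
      (simp_all add: infinite_UNIV Field_card_of card_lessThan_ordinal card_of_singl_ordLeq card_of_card_order_on)
  ultimately have "(card_of (UNIV :: 'a ordinal set), card_of (UNIV :: 'a set)) \<in> ordLeq"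
    using card_of_UNION_ordLeq_infinite[OF infinite_UNIV assms, of "\<lambda>y. {..<y} \<union> {y}"] by simp
  with card_UNIV_ordinal show False ..
qed

lemma image_lessThan_bounded:
  fixes f :: "'a ordinal \<Rightarrow> 'a::infinite ordinal"
  shows "\<exists>x. \<forall>y\<in>f ` {..<b}. y < x"
  by (rule small_set_bounded)
    (rule ordLeq_transitive[OF card_of_image card_lessThan_ordinal])

lemma range_nat_bounded:
  fixes f :: "nat \<Rightarrow> 'a::infinite ordinal"
  shows "\<exists>x. \<forall>y\<in>range f. y < x"
proof (rule small_set_bounded)
  have "(card_of (UNIV :: nat set), card_of (UNIV :: 'a set)) \<in> ordLeq"
    using infinite_UNIV by (simp add: infinite_iff_card_of_nat)
  then show "(card_of (range f), card_of (UNIV :: 'a set)) \<in> ordLeq"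
    by (rule ordLeq_transitive[OF card_of_image])
qed

text \<open>Being strictly below a supremum is an existential statement. The recursive operations
  are therefore unfolded through \<open>x < ...\<close>, and identities are proved by comparing
  strict predecessors.\<close>

lemma less_ord_sup_iff:
  assumes "\<exists>b. \<forall>y\<in>S. y \<le> b"
  shows "x < ord_sup S \<longleftrightarrow> (\<exists>y\<in>S. x < y)"
proof -
  from assms obtain b where b: "\<forall>y\<in>S. y \<le> b" ..
  have up: "\<forall>y\<in>S. y \<le> ord_sup S"
    unfolding ord_sup_def using b by (rule LeastI)
  have "ord_sup S \<le> x" if "\<forall>y\<in>S. y \<le> x"
    unfolding ord_sup_def using that by (rule Least_le)
  then show ?thesis
    using up by (metis less_le_trans not_less)
qed

lemma less_ord_succ_iff: "x < ord_succ a \<longleftrightarrow> x \<le> (a :: 'a::infinite ordinal)"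
proof -
  obtain b where "a < b"
    using range_nat_bounded[of "\<lambda>_. a"] by auto
  then have "a < ord_succ a"
    unfolding ord_succ_def by (rule LeastI)
  moreover have "ord_succ a \<le> x" if "a < x"
    unfolding ord_succ_def using that by (rule Least_le)
  ultimately show ?thesis
    by (cases "a < x") (auto simp: not_less dest: leD intro: le_less_trans)
qed

lemma ord_succ_le_iff: "ord_succ a \<le> x \<longleftrightarrow> (a :: 'a::infinite ordinal) < x"
  by (simp add: less_ord_succ_iff flip: not_less)

lemma zero_le_ordinal [simp]: "0 \<le> (x :: 'a::infinite ordinal)"
  unfolding zero_ordinal_def by (simp add: Least_le)

lemma not_less_zero_ordinal [simp]: "\<not> x < (0 :: 'a::infinite ordinal)"
  by (simp add: not_less)

lemma ordinal_pos_iff: "0 < x \<longleftrightarrow> x \<noteq> (0 :: 'a::infinite ordinal)"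
  by (simp add: less_le)

lemma ordinal_eqI: "(\<And>z. z < x \<longleftrightarrow> z < y) \<Longrightarrow> x = (y :: 'b::linorder)"
  by (metis less_irrefl neqE)

lemma ordinal_leI: "(\<And>z. z < x \<Longrightarrow> z < y) \<Longrightarrow> x \<le> (y :: 'b::linorder)"
  by (meson leI less_irrefl)

subsection \<open>Addition\<close>

lemma less_plus_ordinal_iff':
  "x < a + b \<longleftrightarrow> x < a \<or> (\<exists>b'<b. x \<le> a + (b' :: 'a::infinite ordinal))"
proof -
  obtain c where "\<forall>y\<in>(\<lambda>b'. ord_succ (a + b')) ` {..<b}. y < c"
    using image_lessThan_bounded by blast
  then have "\<exists>c. \<forall>y\<in>insert a ((\<lambda>b'. ord_succ (a + b')) ` {..<b}). y \<le> c"
    by (intro exI[of _ "max a c"]) (auto simp: le_max_iff_disj intro: less_imp_le)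
  from less_ord_sup_iff[OF this] show ?thesis
    by (subst plus_ordinal.simps) (auto simp: less_ord_succ_iff)
qed

lemma le_plus_ordinal [simp]: "a \<le> a + (b :: 'a::infinite ordinal)"
  by (rule ordinal_leI) (simp add: less_plus_ordinal_iff')

lemma plus_ordinal_strict_mono: "b < c \<Longrightarrow> a + b < a + (c :: 'a::infinite ordinal)"
  using less_plus_ordinal_iff'[of "a + b" a c] by auto

lemma plus_ordinal_less_iff [simp]: "a + b < a + c \<longleftrightarrow> b < (c :: 'a::infinite ordinal)"
  by (metis linorder_cases not_less_iff_gr_or_eq plus_ordinal_strict_mono)

lemma plus_ordinal_cancel [simp]: "a + b = a + c \<longleftrightarrow> b = (c :: 'a::infinite ordinal)"
  by (metis linorder_cases less_irrefl plus_ordinal_strict_mono)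

lemma plus_ordinal_le_iff [simp]: "a + b \<le> a + c \<longleftrightarrow> b \<le> (c :: 'a::infinite ordinal)"
  by (simp add: le_less)

lemma le_plus_ordinal2 [simp]: "b \<le> a + (b :: 'a::infinite ordinal)"
  using strict_mono_le_wellorder[of "\<lambda>b. a + b"] by simp

lemma ex_plus_ordinal:
  assumes "a \<le> (x :: 'a::infinite ordinal)"
  shows "\<exists>c. x = a + c"
proof -
  \<comment> \<open>With \<open>c\<close> least, a strict inequality \<open>x < a + c\<close> would
    unfold to a smaller candidate.\<close>
  define c where "c = (LEAST c. x \<le> a + c)"
  have "x \<le> a + c"
    unfolding c_def by (rule LeastI[of _ x]) simp
  moreover have "\<not> x < a + c"
  proof
    assume "x < a + c"
    then obtain c' where "c' < c" "x \<le> a + c'"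
      using assms by (auto simp: less_plus_ordinal_iff')
    then show False
      using not_less_Least[of c' "\<lambda>c. x \<le> a + c"] c_def by auto
  qed
  ultimately show ?thesis
    by (intro exI[of _ c]) simp
qed

text \<open>Subtraction sharpens the unfolded recursion from an inequality to an equation, so that
  the part of \<open>a + b\<close> from \<open>a\<close> on is a shifted copy of
  \<open>b\<close>.\<close>

lemma less_plus_ordinal_iff:
  "x < a + b \<longleftrightarrow> x < a \<or> (\<exists>b'<b. x = a + (b' :: 'a::infinite ordinal))"
  by (metis ex_plus_ordinal leI less_plus_ordinal_iff' order_refl plus_ordinal_less_iff)

lemma zero_plus_ordinal [simp]: "0 + x = (x :: 'a::infinite ordinal)"
proof (induction x rule: less_induct)
  case (less x)
  show ?case
    by (rule ordinal_eqI) (use less less_plus_ordinal_iff[of _ 0 x] in auto)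
qed

lemma plus_zero_ordinal [simp]: "x + 0 = (x :: 'a::infinite ordinal)"
  by (rule ordinal_eqI) (simp add: less_plus_ordinal_iff)

lemma plus_ordinal_assoc: "a + b + c = a + (b + (c :: 'a::infinite ordinal))"
proof (induction c rule: less_induct)
  case (less c)
  show ?case
  proof (rule ordinal_eqI)
    fix x
    have "x < a + b + c \<longleftrightarrow> x < a \<or> (\<exists>b'<b. x = a + b') \<or> (\<exists>c'<c. x = a + b + c')"
      by (simp add: less_plus_ordinal_iff)
    also have "\<dots> \<longleftrightarrow> x < a \<or> (\<exists>b'<b. x = a + b') \<or> (\<exists>c'<c. x = a + (b + c'))"
      using less by auto
    also have "\<dots> \<longleftrightarrow> x < a \<or> (\<exists>d<b + c. x = a + d)"
      by (auto simp: less_plus_ordinal_iff)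
    also have "\<dots> \<longleftrightarrow> x < a + (b + c)"
      by (rule less_plus_ordinal_iff[symmetric])
    finally show "x < a + b + c \<longleftrightarrow> x < a + (b + c)" .
  qed
qed

lemma plus_ordinal_mono:
  assumes "a \<le> a'" "b \<le> (b' :: 'a::infinite ordinal)"
  shows "a + b \<le> a' + b'"
proof -
  have "a + b \<le> a' + b"
  proof (induction b rule: less_induct)
    case (less b)
    show ?case
    proof (rule ordinal_leI)
      fix z assume "z < a + b"
      then consider "z < a" | b' where "b' < b" "z = a + b'"
        by (auto simp: less_plus_ordinal_iff)
      then show "z < a' + b"
      proof cases
        case 1
        then show ?thesis
          using assms(1) less_plus_ordinal_iff[of z a' b] by auto
      next
        case 2
        then show ?thesis
          using less[of b'] by (meson le_less_trans plus_ordinal_strict_mono)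
      qed
    qed
  qed
  then show ?thesis
    using assms(2) by (meson order_trans plus_ordinal_le_iff)
qed

lemma plus_ordinal_eq_0_iff: "a + b = 0 \<longleftrightarrow> a = 0 \<and> b = (0 :: 'a::infinite ordinal)"
  by (metis le_plus_ordinal le_plus_ordinal2 antisym zero_le_ordinal plus_zero_ordinal)

lemma less_one_ordinal_iff [simp]: "x < 1 \<longleftrightarrow> x = (0 :: 'a::infinite ordinal)"
  by (simp add: one_ordinal_def less_ord_succ_iff) (auto intro: antisym)

subsection \<open>Finite ordinals and omega\<close>

definition fin_ord :: "nat \<Rightarrow> 'a::infinite ordinal" where
  "fin_ord n = (ord_succ ^^ n) 0"

lemma fin_ord_0 [simp]: "fin_ord 0 = 0"
  by (simp add: fin_ord_def)

lemma fin_ord_Suc [simp]: "fin_ord (Suc n) = ord_succ (fin_ord n)"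
  by (simp add: fin_ord_def)

lemma less_fin_ord_iff: "x < fin_ord n \<longleftrightarrow> (\<exists>m<n. x = (fin_ord m :: 'a::infinite ordinal))"
  by (induction n) (auto simp: less_ord_succ_iff le_less less_Suc_eq)

lemma fin_ord_less_iff [simp]: "fin_ord m < (fin_ord n :: 'a::infinite ordinal) \<longleftrightarrow> m < n"
proof
  show "m < n" if "fin_ord m < (fin_ord n :: 'a ordinal)"
  proof (rule ccontr)
    assume "\<not> m < n"
    then have "fin_ord n < (fin_ord m :: 'a ordinal) \<or> fin_ord n = (fin_ord m :: 'a ordinal)"
      by (metis less_fin_ord_iff linorder_neqE_nat)
    with that show False by auto
  qed
qed (use less_fin_ord_iff in blast)

text \<open>The least strict upper bound of the finite ordinals is closed under successor, so the
  least element defining \<open>omega\<close> exists.\<close>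

lemma omega_props:
  "0 < (omega :: 'a::infinite ordinal)" "\<And>y. y < omega \<Longrightarrow> ord_succ y < (omega :: 'a::infinite ordinal)"
proof -
  define b where "b = (LEAST x :: 'a ordinal. \<forall>n. fin_ord n < x)"
  obtain x :: "'a ordinal" where x: "\<forall>n. fin_ord n < x"
    using range_nat_bounded[of fin_ord] by auto
  have b: "fin_ord n < b" for n
    using LeastI[of "\<lambda>x. \<forall>n. fin_ord n < x", OF x] by (simp add: b_def)
  have "ord_succ y < b" if "y < b" for y
  proof -
    have "\<not> (\<forall>n. fin_ord n < y)"
      using that not_less_Least[of y "\<lambda>x. \<forall>n. fin_ord n < x"] by (auto simp: b_def)
    then obtain n where "y \<le> fin_ord n"
      by (auto simp: not_less)
    then have "ord_succ y \<le> fin_ord (Suc n)"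
      by (simp add: ord_succ_le_iff less_ord_succ_iff)
    then show ?thesis
      using b le_less_trans by blast
  qed
  moreover have "0 < b"
    using b[of 0] by simp
  ultimately have "0 < b \<and> (\<forall>y<b. ord_succ y < b)"
    by blast
  then have "0 < (omega :: 'a ordinal) \<and> (\<forall>y<omega. ord_succ y < (omega :: 'a ordinal))"
    unfolding omega_def by (rule LeastI)
  then show "0 < (omega :: 'a ordinal)" "\<And>y. y < omega \<Longrightarrow> ord_succ y < (omega :: 'a ordinal)"
    by blast+
qed

lemma fin_ord_less_omega: "fin_ord n < (omega :: 'a::infinite ordinal)"
  by (induction n) (auto simp: omega_props)

lemma less_omega_iff: "x < omega \<longleftrightarrow> (\<exists>n. x = (fin_ord n :: 'a::infinite ordinal))"
proof
  show "\<exists>n. x = (fin_ord n :: 'a ordinal)" if "x < omega"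
    using that
  proof (induction x rule: less_induct)
    case (less x)
    \<comment> \<open>By minimality of \<open>omega\<close>, the smaller \<open>x\<close> is not a
      limit.\<close>
    have "x = 0 \<or> (\<exists>y<x. x \<le> ord_succ y)"
      using not_less_Least[of x "\<lambda>x. 0 < x \<and> (\<forall>y<x. ord_succ y < x)"] less.prems
      by (auto simp: omega_def ordinal_pos_iff not_less)
    then show ?case
    proof
      assume "x = 0"
      then show ?thesis by (metis fin_ord_0)
    next
      assume "\<exists>y<x. x \<le> ord_succ y"
      then obtain y where y: "y < x" "x = ord_succ y"
        by (meson antisym ord_succ_le_iff)
      with less.prems have "y < omega"
        by (metis less_trans)
      with less.IH[of y] y obtain n where "y = fin_ord n" by auto
      with y show ?thesis by (metis fin_ord_Suc)
    qed
  qed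
qed (auto simp: fin_ord_less_omega)

subsection \<open>Multiplication by finite ordinals and by omega\<close>

lemma less_times_ordinal_iff:
  "x < a * b \<longleftrightarrow> (\<exists>b'<b. x < a * b' + (a :: 'a::infinite ordinal))"
proof -
  obtain c where "\<forall>y\<in>(\<lambda>b'. a * b' + a) ` {..<b}. y < c"
    using image_lessThan_bounded by blast
  then have "\<exists>c. \<forall>y\<in>(\<lambda>b'. a * b' + a) ` {..<b}. y \<le> c"
    by (meson less_imp_le)
  from less_ord_sup_iff[OF this] show ?thesis
    by (subst times_ordinal.simps) auto
qed

lemma times_ordinal_mono: "b \<le> c \<Longrightarrow> a * b \<le> a * (c :: 'a::infinite ordinal)"
  by (rule ordinal_leI) (meson less_le_trans less_times_ordinal_iff)

lemma times_0_ordinal [simp]: "a * 0 = (0 :: 'a::infinite ordinal)"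
  using less_times_ordinal_iff[of 0 a 0] by (auto simp: ordinal_pos_iff)

lemma times_succ_ordinal: "a * ord_succ b = a * b + (a :: 'a::infinite ordinal)"
proof (rule ordinal_eqI)
  fix x
  show "x < a * ord_succ b \<longleftrightarrow> x < a * b + a"
    unfolding less_times_ordinal_iff[of x a "ord_succ b"] less_ord_succ_iff
    by (meson less_le_trans order_refl plus_ordinal_mono times_ordinal_mono)
qed

text \<open>The recursion appends a copy of \<open>a\<close> on the right; Cantor normal forms are
  built by prepending on the left.\<close>

lemma times_fin_Suc': "a * ord_succ (fin_ord n) = a + a * (fin_ord n :: 'a::infinite ordinal)"
proof (induction n)
  case (Suc n)
  have "a * ord_succ (fin_ord (Suc n)) = a * ord_succ (fin_ord n) + a"
    by (simp add: times_succ_ordinal)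
  also have "\<dots> = a + (a * fin_ord n + a)"
    by (simp add: Suc.IH plus_ordinal_assoc)
  finally show ?case
    by (simp add: times_succ_ordinal)
qed (simp add: times_succ_ordinal)

lemma times_fin_add:
  "a * fin_ord m + a * fin_ord n = a * (fin_ord (m + n) :: 'a::infinite ordinal)"
  by (induction n) (simp_all add: times_succ_ordinal plus_ordinal_assoc[symmetric])

lemma less_times_omega_iff:
  "x < a * omega \<longleftrightarrow> (\<exists>n. x < a * (fin_ord n :: 'a::infinite ordinal))"
proof
  assume "x < a * omega"
  then obtain n where "x < a * fin_ord n + a"
    by (auto simp: less_times_ordinal_iff[of x a omega] less_omega_iff)
  then have "x < a * fin_ord (Suc n)"
    by (simp add: times_succ_ordinal)
  then show "\<exists>n. x < a * fin_ord n" ..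
next
  assume "\<exists>n. x < a * fin_ord n"
  then show "x < a * omega"
    by (meson fin_ord_less_omega less_imp_le less_le_trans times_ordinal_mono)
qed

subsection \<open>Powers of omega\<close>

text \<open>Multiplication by \<open>omega\<close> dissolves into finite multiples; the value
  \<open>1\<close> inserted in the recursion accounts for \<open>x = 0\<close>.\<close>

lemma less_omega_pow_iff:
  "x < omega_pow b \<longleftrightarrow> x = 0 \<or> (\<exists>b'<b. \<exists>n. x < omega_pow b' * (fin_ord n :: 'a::infinite ordinal))"
proof -
  obtain c where "\<forall>y\<in>(\<lambda>b'. omega_pow b' * omega) ` {..<b}. y < c"
    using image_lessThan_bounded by blast
  then have "\<exists>c. \<forall>y\<in>insert 1 ((\<lambda>b'. omega_pow b' * omega) ` {..<b}). y \<le> c"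
    by (intro exI[of _ "max 1 c"]) (auto simp: le_max_iff_disj intro: less_imp_le)
  from less_ord_sup_iff[OF this] show ?thesis
    by (subst ord_power.simps) (auto simp: less_times_omega_iff)
qed

lemma omega_pow_0 [simp]: "omega_pow 0 = (1 :: 'a::infinite ordinal)"
  by (rule ordinal_eqI) (simp add: less_omega_pow_iff)

lemma omega_pow_pos [simp]: "0 < omega_pow (b :: 'a::infinite ordinal)"
  by (simp add: less_omega_pow_iff)

lemma omega_pow_neq_0 [simp]: "omega_pow (b :: 'a::infinite ordinal) \<noteq> 0"
  using omega_pow_pos[of b] by (simp only: ordinal_pos_iff not_False_eq_True)

lemma omega_pow_mono: "a \<le> b \<Longrightarrow> omega_pow a \<le> omega_pow (b :: 'a::infinite ordinal)"
  by (rule ordinal_leI)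
    (auto simp: less_omega_pow_iff[of _ a] less_omega_pow_iff[of _ b] dest: less_le_trans)

lemma omega_pow_times_fin_less:
  "a < b \<Longrightarrow> omega_pow a * fin_ord n < omega_pow (b :: 'a::infinite ordinal)"
proof -
  assume "a < b"
  moreover have "omega_pow a * fin_ord n < omega_pow a * fin_ord (Suc n)"
    using plus_ordinal_strict_mono[OF omega_pow_pos[of a], of "omega_pow a * fin_ord n"]
    by (simp add: times_succ_ordinal)
  ultimately show ?thesis
    by (subst less_omega_pow_iff) blast
qed

lemma times_one_ordinal [simp]: "a * 1 = (a :: 'a::infinite ordinal)"
  by (simp add: one_ordinal_def times_succ_ordinal)

lemma omega_pow_strict_mono: "a < b \<Longrightarrow> omega_pow a < omega_pow (b :: 'a::infinite ordinal)"
  using omega_pow_times_fin_less[of a b 1] by (simp add: one_ordinal_def[symmetric])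

lemma omega_pow_less_iff [simp]: "omega_pow a < omega_pow b \<longleftrightarrow> a < (b :: 'a::infinite ordinal)"
  by (meson leD leI omega_pow_mono omega_pow_strict_mono)

lemma le_omega_pow: "b \<le> omega_pow (b :: 'a::infinite ordinal)"
  using strict_mono_le_wellorder[of omega_pow] by simp

lemma less_omega_pow_times_fin_mono:
  assumes "x < omega_pow a * fin_ord m" "a \<le> (b :: 'a::infinite ordinal)"
  obtains n where "x < omega_pow b * fin_ord n"
proof (cases "a = b")
  case True
  with assms that show ?thesis by blast
next
  case False
  then have "x < omega_pow b * fin_ord 1"
    using assms(2) less_trans[OF assms(1) omega_pow_times_fin_less[of a b m]]
    by (simp add: one_ordinal_def[symmetric])
  with that show ?thesis .
qed

lemma omega_pow_succ: "omega_pow (ord_succ b) = omega_pow b * (omega :: 'a::infinite ordinal)"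
proof (rule ordinal_eqI)
  fix x
  have *: "\<exists>n. x < omega_pow b * fin_ord n" if "b' \<le> b" "x < omega_pow b' * fin_ord n" for b' n
    using less_omega_pow_times_fin_mono[OF that(2,1)] by blast
  have "\<exists>n. (0 :: 'a ordinal) < omega_pow b * fin_ord n"
    by (rule exI[of _ 1]) (simp add: one_ordinal_def[symmetric])
  with * show "x < omega_pow (ord_succ b) \<longleftrightarrow> x < omega_pow b * omega"
    unfolding less_omega_pow_iff[of x "ord_succ b"] less_ord_succ_iff less_times_omega_iff
    by blast
qed

text \<open>Additive indecomposability: both arguments lie below finite multiples of a common
  \<open>omega_pow d\<close> with \<open>d < c\<close>, and finite multiples add up.\<close>

lemma omega_pow_plus_closed:
  assumes "x < omega_pow c" "y < omega_pow (c :: 'a::infinite ordinal)"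
  shows "x + y < omega_pow c"
proof (cases "x = 0 \<or> y = 0")
  case False
  then obtain a m b n where *: "a < c" "x < omega_pow a * fin_ord m"
      "b < c" "y < omega_pow b * fin_ord n"
    using assms by (auto simp: less_omega_pow_iff[of _ c])
  define d where "d = max a b"
  have d: "d < c" "a \<le> d" "b \<le> d"
    using * by (auto simp: d_def)
  from *(2) d(2) obtain m' where "x < omega_pow d * fin_ord m'"
    by (rule less_omega_pow_times_fin_mono)
  moreover from *(4) d(3) obtain n' where "y < omega_pow d * fin_ord n'"
    by (rule less_omega_pow_times_fin_mono)
  ultimately have "x + y < omega_pow d * fin_ord (m' + n')"
    unfolding times_fin_add[symmetric]
    by (intro le_less_trans[OF plus_ordinal_mono plus_ordinal_strict_mono]) simp_all
  with d show ?thesis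
    using omega_pow_times_fin_less less_trans by blast
qed (use assms in auto)

lemma omega_pow_absorb:
  assumes "a < omega_pow (c :: 'a::infinite ordinal)"
  shows "a + omega_pow c = omega_pow c"
proof (rule antisym)
  show "a + omega_pow c \<le> omega_pow c"
  proof (rule ordinal_leI)
    fix z assume "z < a + omega_pow c"
    then show "z < omega_pow c"
      using assms omega_pow_plus_closed by (auto simp: less_plus_ordinal_iff)
  qed
qed simp

lemma times_fin_less_omega_pow:
  assumes "x < omega_pow (c :: 'a::infinite ordinal)"
  shows "x * fin_ord n < omega_pow c"
  by (induction n) (auto simp: times_succ_ordinal omega_pow_plus_closed assms)

lemma times_omega_mono:
  assumes "a \<le> (b :: 'a::infinite ordinal)"
  shows "a * omega \<le> b * omega"
proof -
  have "a * fin_ord n \<le> b * fin_ord n" for n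
    by (induction n) (auto simp: times_succ_ordinal plus_ordinal_mono assms)
  then show ?thesis
    by (intro ordinal_leI) (meson less_le_trans less_times_omega_iff)
qed

text \<open>Finite multiples of the sum stay below \<open>omega_pow (ord_succ b)\<close> by
  indecomposability, while the first summand alone already reaches it after \<open>omega\<close>
  copies.\<close>

lemma omega_pow_plus_times_omega:
  assumes "c \<le> (b :: 'a::infinite ordinal)"
  shows "(omega_pow b + omega_pow c) * omega = omega_pow (ord_succ b)"
proof (rule antisym)
  have "omega_pow b < omega_pow (ord_succ b)" "omega_pow c < omega_pow (ord_succ b)"
    using assms by (auto simp: less_ord_succ_iff)
  then have "omega_pow b + omega_pow c < omega_pow (ord_succ b)"
    by (rule omega_pow_plus_closed)
  then show "(omega_pow b + omega_pow c) * omega \<le> omega_pow (ord_succ b)"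
    by (intro ordinal_leI) (meson less_times_omega_iff less_trans times_fin_less_omega_pow)
  show "omega_pow (ord_succ b) \<le> (omega_pow b + omega_pow c) * omega"
    unfolding omega_pow_succ by (rule times_omega_mono) simp
qed

text \<open>The supremum of the tower 0, 1, \<omega>, \<omega>^\<omega>, ... is a fixed point, so
  the least element defining \<open>epsilon0\<close> exists.\<close>

lemma ex_omega_pow_fixpoint: "\<exists>x :: 'a::infinite ordinal. x = omega_pow x"
proof -
  define f :: "nat \<Rightarrow> 'a ordinal" where "f n = (omega_pow ^^ n) 0" for n
  obtain b where b: "\<forall>y\<in>range f. y < b"
    using range_nat_bounded by blast
  then have "\<exists>b. \<forall>y\<in>range f. y \<le> b"
    by (meson less_imp_le)
  note sup = less_ord_sup_iff[OF this]
  let ?s = "ord_sup (range f)"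
  have step: "f (Suc n) = omega_pow (f n)" for n
    by (simp add: f_def)
  have "0 < f (Suc n)" for n
    by (simp add: step)
  then have "0 < ?s"
    by (auto simp: sup)
  have "omega_pow ?s \<le> ?s"
  proof (rule ordinal_leI)
    fix x assume "x < omega_pow ?s"
    then show "x < ?s"
      unfolding less_omega_pow_iff[of x ?s]
    proof (elim disjE exE conjE)
      fix b' n assume "b' < ?s" and x: "x < omega_pow b' * fin_ord n"
      then obtain k where "b' < f k"
        by (auto simp: sup)
      then have "x < f (Suc k)"
        using x omega_pow_times_fin_less[of b' "f k" n] by (simp add: step)
      then show "x < ?s"
        by (auto simp: sup)
    qed (use \<open>0 < ?s\<close> in simp)
  qed
  then show ?thesis
    using le_omega_pow antisym by blast
qed

lemma one_less_epsilon0: "1 < (epsilon0 :: 'a::infinite ordinal)"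
proof -
  have fixpoint: "(epsilon0 :: 'a ordinal) = omega_pow epsilon0"
    unfolding epsilon0_def using ex_omega_pow_fixpoint by (rule LeastI_ex)
  then have "0 < (epsilon0 :: 'a ordinal)"
    by (metis omega_pow_pos)
  then have "omega_pow 0 < omega_pow (epsilon0 :: 'a ordinal)"
    by (rule omega_pow_strict_mono)
  with fixpoint show ?thesis by simp
qed

subsection \<open>Cantor normal form\<close>

lemma omega_sum_Nil [simp]: "omega_sum [] = (0 :: 'a::infinite ordinal)"
  by (simp add: omega_sum_def)

lemma omega_sum_Cons [simp]:
  "omega_sum (a # as) = omega_pow a + (omega_sum as :: 'a::infinite ordinal)"
  by (simp add: omega_sum_def)

lemma omega_sum_append:
  "omega_sum (as @ bs) = omega_sum as + (omega_sum bs :: 'a::infinite ordinal)"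
  by (induction as) (simp_all add: plus_ordinal_assoc)

lemma omega_sum_less_omega_pow:
  assumes "\<And>a. a \<in> set as \<Longrightarrow> a < (c :: 'a::infinite ordinal)"
  shows "omega_sum as < omega_pow c"
  using assms by (induction as) (auto intro: omega_pow_plus_closed)

lemma omega_pow_le_omega_sum:
  assumes "a \<in> set as"
  shows "omega_pow a \<le> (omega_sum as :: 'a::infinite ordinal)"
  using assms by (induction as) (auto intro: order_trans[OF _ le_plus_ordinal2])

lemma omega_sum_inject:
  assumes "nonincreasing as" "nonincreasing bs" "omega_sum as = (omega_sum bs :: 'a::infinite ordinal)"
  shows "as = bs"
  using assms
proof (induction as arbitrary: bs)
  case Nil
  then show ?case
    by (cases bs) (auto simp: plus_ordinal_eq_0_iff dest: sym[of 0])
next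
  case (Cons a as)
  then obtain b bs' where bs: "bs = b # bs'"
    by (cases bs) (auto simp: plus_ordinal_eq_0_iff)
  \<comment> \<open>The power of the larger leading exponent alone exceeds the whole other sum, so
    equal sums have equal leading exponents.\<close>
  have gap: "omega_sum (x # xs) < omega_sum (y # ys)" if "nonincreasing (x # xs)" "x < y"
    for x y :: "'a ordinal" and xs ys
  proof -
    have "omega_sum (x # xs) < omega_pow y"
      by (rule omega_sum_less_omega_pow) (use that in \<open>auto simp: nonincreasing_def\<close>)
    also have "\<dots> \<le> omega_sum (y # ys)" by simp
    finally show ?thesis .
  qed
  have "a = b"
    using gap Cons.prems bs by (metis less_irrefl neqE)
  moreover have "as = bs'"
    using Cons bs \<open>a = b\<close> by (auto simp: nonincreasing_def)
  ultimately show ?case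
    using bs by simp
qed

lemma ex_omega_pow_le:
  assumes "x \<noteq> (0 :: 'a::infinite ordinal)"
  shows "\<exists>b n y. x = omega_pow b * fin_ord (Suc n) + y \<and> y < omega_pow b"
proof -
  \<comment> \<open>Minimality of \<open>c\<close> makes the \<open>b < c\<close> found below the
    leading exponent: \<open>omega_pow b \<le> x\<close>, and finitely many copies exceed
    \<open>x\<close>.\<close>
  define c where "c = (LEAST c. x < omega_pow c)"
  have "x < omega_pow (ord_succ x)"
    using le_omega_pow[of "ord_succ x"] by (simp add: ord_succ_le_iff)
  then have c: "x < omega_pow c"
    unfolding c_def by (rule LeastI)
  then obtain b n where b: "b < c" "x < omega_pow b * fin_ord n"
    using assms by (auto simp: less_omega_pow_iff[of x c])
  have "omega_pow b \<le> x"
    using not_less_Least[of b "\<lambda>c. x < omega_pow c"] b by (simp add: c_def not_less)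
  define m where "m = (LEAST m. x < omega_pow b * fin_ord m)"
  have m: "x < omega_pow b * fin_ord m"
    unfolding m_def using b(2) by (rule LeastI)
  \<comment> \<open>Since \<open>omega_pow b \<le> x\<close>, the first multiple exceeding
    \<open>x\<close> is at least the second; hence the leading coefficient \<open>m - 1\<close> is
    positive.\<close>
  have "m \<noteq> 0"
    using m by (intro notI) simp
  moreover have "m \<noteq> 1"
    using m \<open>omega_pow b \<le> x\<close> by (intro notI) (simp add: one_ordinal_def[symmetric])
  ultimately obtain k where k: "m = Suc (Suc k)"
    by (metis One_nat_def not0_implies_Suc)
  have "omega_pow b * fin_ord (Suc k) \<le> x"
    using not_less_Least[of "Suc k" "\<lambda>m. x < omega_pow b * fin_ord m"] k
    by (simp add: m_def not_less)
  then obtain y where y: "x = omega_pow b * fin_ord (Suc k) + y"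
    using ex_plus_ordinal by blast
  then have "y < omega_pow b"
    using m by (simp add: k times_succ_ordinal)
  with y show ?thesis by blast
qed

lemma ex_omega_sum: "\<exists>as. nonincreasing as \<and> x = (omega_sum as :: 'a::infinite ordinal)"
proof (induction x rule: less_induct)
  case (less x)
  show ?case
  proof (cases "x = 0")
    case True
    then show ?thesis
      by (intro exI[of _ "[]"]) (simp add: nonincreasing_def)
  next
    case False
    then obtain b n y where x: "x = omega_pow b * fin_ord (Suc n) + y" and y: "y < omega_pow b"
      using ex_omega_pow_le by blast
    have "omega_pow b \<le> x"
      by (simp add: x times_fin_Suc' plus_ordinal_assoc)
    with y obtain as where as: "nonincreasing as" "y = omega_sum as"
      using less by (meson less_le_trans)
    have small: "a < b" if "a \<in> set as" for a
      using omega_pow_le_omega_sum[OF that] y as(2) by (metis le_less_trans omega_pow_less_iff)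
    have "omega_sum (replicate k b) = omega_pow b * fin_ord k" for k
      by (induction k) (simp_all add: times_fin_Suc')
    then have "x = omega_sum (replicate (Suc n) b @ as)"
      using x as by (simp only: omega_sum_append)
    moreover have "nonincreasing (replicate k b @ as)" for k
      using as(1) small
      by (induction k) (auto simp: nonincreasing_def sorted_wrt_append less_imp_le)
    ultimately show ?thesis by blast
  qed
qed

lemma cnf_props: "nonincreasing (cnf x)" "omega_sum (cnf x) = (x :: 'a::infinite ordinal)"
proof -
  have "\<exists>!as. nonincreasing as \<and> x = omega_sum as"
    using ex_omega_sum omega_sum_inject by metis
  then have "nonincreasing (cnf x) \<and> x = omega_sum (cnf x)"
    unfolding cnf_def by (rule theI')
  then show "nonincreasing (cnf x)" "omega_sum (cnf x) = x"
    by auto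
qed

lemma cnf_omega_sum: "nonincreasing as \<Longrightarrow> cnf (omega_sum as) = as"
  by (rule omega_sum_inject) (auto simp: cnf_props)

lemma less_omega_pow_iff_cnf:
  "x < omega_pow c \<longleftrightarrow> (\<forall>a\<in>set (cnf x). a < (c :: 'a::infinite ordinal))"
  by (metis cnf_props(2) le_less_trans omega_pow_le_omega_sum omega_pow_less_iff
      omega_sum_less_omega_pow)

lemma nonincreasing_iff_sorted_rev: "nonincreasing as \<longleftrightarrow> sorted (rev as)"
  by (simp add: nonincreasing_def sorted_wrt_rev)

text \<open>Prepending the largest exponent leaves the merged list sorted. This turns the additivity
  of \<open>N\<close> for natural sums into a statement about ordinary normal forms.\<close>

lemma foldr_natural_sum:
  assumes "nonincreasing as"
  shows "foldr (\<oplus>) (map omega_pow as) 0 = (omega_sum as :: 'a::infinite ordinal)"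
  using assms
proof (induction as)
  case (Cons a as)
  then have as: "nonincreasing as"
    by (simp add: nonincreasing_def)
  have a: "cnf (omega_pow a) = [a]"
    using cnf_omega_sum[of "[a]"] by (simp add: nonincreasing_def)
  have "sort (a # as) = rev (a # as)"
    using Cons.prems by (intro properties_for_sort) (auto simp: nonincreasing_iff_sorted_rev)
  then have "rev (sort (a # as)) = a # as"
    by simp
  with Cons.IH[OF as] show ?case
    by (simp add: natural_sum_def a cnf_omega_sum[OF as] del: sort_key_simps)
qed simp

section \<open>Monadic equivalence up to a quantifier depth\<close>

text \<open>Singletons represent element variables, and inclusion then expresses both equality and
  membership. Emptiness is recorded so that the atoms of an ordered sum can be computed from those
  of its blocks.\<close>

definition atoms :: "'v set \<Rightarrow> ('v \<Rightarrow> 'b::linorder set) \<Rightarrow>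
    'v set \<times> 'v set \<times> ('v \<times> 'v) set \<times> ('v \<times> 'v) set" where
  "atoms V W = ({v\<in>V. W v = {}}, {v\<in>V. \<exists>x. W v = {x}}, {(v, w)\<in>V \<times> V. W v \<subseteq> W w},
     {(v, w)\<in>V \<times> V. \<exists>x\<in>W v. \<exists>y\<in>W w. x < y})"

lemma atoms_eq_iff:
  "atoms V W = atoms V W' \<longleftrightarrow>
     (\<forall>v\<in>V. W v = {} \<longleftrightarrow> W' v = {}) \<and> (\<forall>v\<in>V. (\<exists>x. W v = {x}) \<longleftrightarrow> (\<exists>x. W' v = {x})) \<and>
     (\<forall>v\<in>V. \<forall>w\<in>V. W v \<subseteq> W w \<longleftrightarrow> W' v \<subseteq> W' w) \<and>
     (\<forall>v\<in>V. \<forall>w\<in>V. (\<exists>x\<in>W v. \<exists>y\<in>W w. x < y) \<longleftrightarrow> (\<exists>x\<in>W' v. \<exists>y\<in>W' w. x < y))"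
proof -
  have *: "{v\<in>V. P v} = {v\<in>V. Q v} \<longleftrightarrow> (\<forall>v\<in>V. P v \<longleftrightarrow> Q v)" for P Q
    by blast
  have **: "{(v, w)\<in>V \<times> V. P v w} = {(v, w)\<in>V \<times> V. Q v w} \<longleftrightarrow>
      (\<forall>v\<in>V. \<forall>w\<in>V. P v w \<longleftrightarrow> Q v w)" for P Q
    by (simp add: set_eq_iff) blast
  show ?thesis
    by (simp only: atoms_def prod.inject * **)
qed

text \<open>
  Ehrenfeucht-Fraisse equivalence with set moves only: a move reassigns one of the finitely many
  variables in \<open>V\<close> to a subset of the universe. Element variables are represented by singletons.
\<close>

primrec mso_equiv :: "'v set \<Rightarrow> nat \<Rightarrow> 'b::linorder set \<Rightarrow> ('v \<Rightarrow> 'b set) \<Rightarrow>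
    'c::linorder set \<Rightarrow> ('v \<Rightarrow> 'c set) \<Rightarrow> bool" where
  "mso_equiv V 0 A W B W' \<longleftrightarrow> atoms V W = atoms V W'"
| "mso_equiv V (Suc k) A W B W' \<longleftrightarrow> atoms V W = atoms V W' \<and>
     (\<forall>v\<in>V. (\<forall>X. X \<subseteq> A \<longrightarrow> (\<exists>Y. Y \<subseteq> B \<and> mso_equiv V k A (W(v := X)) B (W'(v := Y)))) \<and>
             (\<forall>Y. Y \<subseteq> B \<longrightarrow> (\<exists>X. X \<subseteq> A \<and> mso_equiv V k A (W(v := X)) B (W'(v := Y)))))"

lemma mso_equiv_atoms: "mso_equiv V k A W B W' \<Longrightarrow> atoms V W = atoms V W'"
  by (cases k) auto

lemma mso_equiv_forth:
  assumes "mso_equiv V (Suc k) A W B W'" "v \<in> V" "X \<subseteq> A"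
  obtains Y where "Y \<subseteq> B" "mso_equiv V k A (W(v := X)) B (W'(v := Y))"
  using assms unfolding mso_equiv.simps by meson

lemma mso_equiv_back:
  assumes "mso_equiv V (Suc k) A W B W'" "v \<in> V" "Y \<subseteq> B"
  obtains X where "X \<subseteq> A" "mso_equiv V k A (W(v := X)) B (W'(v := Y))"
  using assms unfolding mso_equiv.simps by meson

lemma mso_equiv_SucI:
  assumes "atoms V W = atoms V W'"
    and "\<And>v X. v \<in> V \<Longrightarrow> X \<subseteq> A \<Longrightarrow> \<exists>Y\<subseteq>B. mso_equiv V k A (W(v := X)) B (W'(v := Y))"
    and "\<And>v Y. v \<in> V \<Longrightarrow> Y \<subseteq> B \<Longrightarrow> \<exists>X\<subseteq>A. mso_equiv V k A (W(v := X)) B (W'(v := Y))"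
  shows "mso_equiv V (Suc k) A W B W'"
  using assms unfolding mso_equiv.simps by meson

lemma mso_equiv_refl: "mso_equiv V k A W A W"
  by (induction k arbitrary: W) auto

lemma mso_equiv_sym: "mso_equiv V k A W B W' \<Longrightarrow> mso_equiv V k B W' A W"
proof (induction k arbitrary: W W')
  case (Suc k)
  then show ?case
    unfolding mso_equiv.simps by metis
qed simp

lemma mso_equiv_trans:
  "mso_equiv V k A W B W' \<Longrightarrow> mso_equiv V k B W' C W'' \<Longrightarrow> mso_equiv V k A W C W''"
proof (induction k arbitrary: W W' W'')
  case (Suc k)
  show ?case
  proof (rule mso_equiv_SucI)
    show "atoms V W = atoms V W''"
      using Suc.prems by simp
  next
    fix v X assume v: "v \<in> V" and "X \<subseteq> A"
    with Suc.prems(1) obtain Y where Y: "Y \<subseteq> B" "mso_equiv V k A (W(v := X)) B (W'(v := Y))"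
      by (rule mso_equiv_forth)
    from Suc.prems(2) v Y(1) obtain Z where
        "Z \<subseteq> C" "mso_equiv V k B (W'(v := Y)) C (W''(v := Z))"
      by (rule mso_equiv_forth)
    then show "\<exists>Z\<subseteq>C. mso_equiv V k A (W(v := X)) C (W''(v := Z))"
      using Suc.IH[OF Y(2)] by blast
  next
    fix v Z assume v: "v \<in> V" and "Z \<subseteq> C"
    with Suc.prems(2) obtain Y where Y: "Y \<subseteq> B" "mso_equiv V k B (W'(v := Y)) C (W''(v := Z))"
      by (rule mso_equiv_back)
    from Suc.prems(1) v Y(1) obtain X where
        "X \<subseteq> A" "mso_equiv V k A (W(v := X)) B (W'(v := Y))"
      by (rule mso_equiv_back)
    then show "\<exists>X\<subseteq>A. mso_equiv V k A (W(v := X)) C (W''(v := Z))"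
      using Suc.IH[OF _ Y(2)] by blast
  qed
qed simp

lemma mso_equiv_image:
  assumes f: "strict_mono_on A f" and W: "\<And>v. v \<in> V \<Longrightarrow> W v \<subseteq> A"
  shows "mso_equiv V k A W (f ` A) (\<lambda>v. f ` W v)"
  using W
proof (induction k arbitrary: W)
  case 0
  have inj: "inj_on f A"
    using f by (rule strict_mono_on_imp_inj_on)
  have less: "f x < f y \<longleftrightarrow> x < y" if "x \<in> A" "y \<in> A" for x y
    using f that by (rule strict_mono_on_less)
  have "(\<exists>x. f ` W v = {x}) \<longleftrightarrow> (\<exists>x. W v = {x})" if "v \<in> V" for v
  proof
    assume "\<exists>x. f ` W v = {x}"
    then have "card (f ` W v) = 1" by auto
    then have "card (W v) = 1"
      using card_image[OF inj_on_subset[OF inj 0[OF that]]] by simp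
    then show "\<exists>x. W v = {x}"
      by (simp add: card_1_singleton_iff)
  qed auto
  moreover have "f ` W v \<subseteq> f ` W w \<longleftrightarrow> W v \<subseteq> W w" if "v \<in> V" "w \<in> V" for v w
  proof
    assume sub: "f ` W v \<subseteq> f ` W w"
    show "W v \<subseteq> W w"
    proof
      fix x assume x: "x \<in> W v"
      with sub obtain y where y: "y \<in> W w" "f x = f y"
        by blast
      then have "x = y"
        using inj_onD[OF inj y(2)] 0[OF that(1)] 0[OF that(2)] x by blast
      with y show "x \<in> W w" by simp
    qed
  qed (rule image_mono)
  moreover have "(\<exists>x\<in>f ` W v. \<exists>y\<in>f ` W w. x < y) \<longleftrightarrow> (\<exists>x\<in>W v. \<exists>y\<in>W w. x < y)"
    if "v \<in> V" "w \<in> V" for v w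
  proof -
    have "(\<exists>x\<in>f ` W v. \<exists>y\<in>f ` W w. x < y) \<longleftrightarrow> (\<exists>x\<in>W v. \<exists>y\<in>W w. f x < f y)"
      by simp
    also have "\<dots> \<longleftrightarrow> (\<exists>x\<in>W v. \<exists>y\<in>W w. x < y)"
      using 0[OF that(1)] 0[OF that(2)] by (intro bex_cong refl less) auto
    finally show ?thesis .
  qed
  ultimately show ?case
    by (simp add: atoms_eq_iff)
next
  case (Suc k)
  have upd: "mso_equiv V k A (W(v := X)) (f ` A) ((\<lambda>v. f ` W v)(v := f ` X))" if "X \<subseteq> A" for v X
  proof -
    have *: "(\<lambda>v. f ` W v)(v := f ` X) = (\<lambda>u. f ` (W(v := X)) u)"
      by (simp add: fun_eq_iff)
    show ?thesis
      unfolding * by (rule Suc.IH) (use Suc.prems that in auto)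
  qed
  have at: "atoms V W = atoms V (\<lambda>v. f ` W v)"
    by (rule mso_equiv_atoms[OF Suc.IH]) (rule Suc.prems)
  have backward: "\<exists>X. X \<subseteq> A \<and> mso_equiv V k A (W(v := X)) (f ` A) ((\<lambda>v. f ` W v)(v := Y))"
    if "Y \<subseteq> f ` A" for v Y
  proof -
    from that obtain X where "X \<subseteq> A" "Y = f ` X"
      by (auto simp: subset_image_iff)
    with upd show ?thesis by blast
  qed
  show ?case
  proof (rule mso_equiv_SucI)
    fix v X assume "X \<subseteq> A"
    then show "\<exists>Y\<subseteq>f ` A. mso_equiv V k A (W(v := X)) (f ` A) ((\<lambda>v. f ` W v)(v := Y))"
      by (intro exI[of _ "f ` X"] conjI image_mono upd)
  qed (rule at, rule backward)
qed

section \<open>Composition of games along ordered sums\<close>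

text \<open>A sum of linear orders realised inside one linear order. The index type is
  \<open>bool\<close> for binary sums and \<open>nat\<close> for sums of length
  \<open>omega\<close>; blocks may be empty.\<close>

definition ordered_blocks :: "'i::linorder set \<Rightarrow> ('i \<Rightarrow> 'b::linorder set) \<Rightarrow> bool" where
  "ordered_blocks I A \<longleftrightarrow> (\<forall>s\<in>I. \<forall>t\<in>I. s < t \<longrightarrow> (\<forall>x\<in>A s. \<forall>y\<in>A t. x < y))"

lemma ordered_blocksD:
  "ordered_blocks I A \<Longrightarrow> s \<in> I \<Longrightarrow> t \<in> I \<Longrightarrow> s < t \<Longrightarrow> x \<in> A s \<Longrightarrow> y \<in> A t \<Longrightarrow> x < y"
  by (simp add: ordered_blocks_def)

lemma ordered_blocks_disjoint:
  assumes "ordered_blocks I A" "s \<in> I" "t \<in> I" "s \<noteq> t" "x \<in> A t"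
  shows "x \<notin> A s"
  using assms ordered_blocksD[OF assms(1), of s t x x] ordered_blocksD[OF assms(1), of t s x x]
  by (cases s t rule: linorder_cases) auto

text \<open>Each atom of the union is expressed by block atoms and the order of the indices, which
  both sums share. A pair \<open>x < y\<close> across different blocks amounts to nonemptiness in
  two blocks with increasing indices.\<close>

lemma atoms_Union:
  fixes I :: "'i::linorder set"
  assumes A: "ordered_blocks I A"
    and B: "ordered_blocks I B"
    and W: "\<And>v. v \<in> V \<Longrightarrow> W v \<subseteq> (\<Union>t\<in>I. A t)"
    and W': "\<And>v. v \<in> V \<Longrightarrow> W' v \<subseteq> (\<Union>t\<in>I. B t)"
    and eq: "\<And>t. t \<in> I \<Longrightarrow> atoms V (\<lambda>v. W v \<inter> A t) = atoms V (\<lambda>v. W' v \<inter> B t)"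
  shows "atoms V W = atoms V W'"
proof -
  have empty: "P = {} \<longleftrightarrow> (\<forall>t\<in>I. P \<inter> C t = {})" if "P \<subseteq> (\<Union>t\<in>I. C t)" for P and C :: "'i \<Rightarrow> 'x set"
    using that by blast
  have sub: "P \<subseteq> Q \<longleftrightarrow> (\<forall>t\<in>I. P \<inter> C t \<subseteq> Q \<inter> C t)" if "P \<subseteq> (\<Union>t\<in>I. C t)"
    for P Q and C :: "'i \<Rightarrow> 'x set"
    using that by blast
  have sing: "(\<exists>x. P = {x}) \<longleftrightarrow> (\<exists>t\<in>I. (\<exists>x. P \<inter> C t = {x}) \<and> (\<forall>s\<in>I. s \<noteq> t \<longrightarrow> P \<inter> C s = {}))"
    if C: "ordered_blocks I C"
      and P: "P \<subseteq> (\<Union>t\<in>I. C t)" for P and C :: "'i \<Rightarrow> 'x::linorder set"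
  proof
    assume "\<exists>x. P = {x}"
    then obtain x where x: "P = {x}" ..
    then obtain t where t: "t \<in> I" "x \<in> C t"
      using P by auto
    have "x \<notin> C s" if "s \<in> I" "s \<noteq> t" for s
      using C that(1) t(1) that(2) t(2) by (rule ordered_blocks_disjoint)
    then show "\<exists>t\<in>I. (\<exists>x. P \<inter> C t = {x}) \<and> (\<forall>s\<in>I. s \<noteq> t \<longrightarrow> P \<inter> C s = {})"
      using t x by (intro bexI[of _ t]) auto
  next
    assume "\<exists>t\<in>I. (\<exists>x. P \<inter> C t = {x}) \<and> (\<forall>s\<in>I. s \<noteq> t \<longrightarrow> P \<inter> C s = {})"
    then obtain t x where t: "t \<in> I" "P \<inter> C t = {x}" "\<forall>s\<in>I. s \<noteq> t \<longrightarrow> P \<inter> C s = {}"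
      by blast
    have "y \<in> C t" if "y \<in> P" for y
    proof -
      from P that have "y \<in> (\<Union>t\<in>I. C t)"
        by (rule subsetD)
      then obtain s where s: "s \<in> I" "y \<in> C s"
        by auto
      then show ?thesis
        using t(3) that by (cases "s = t") auto
    qed
    then have "P \<inter> C t = P"
      by blast
    then show "\<exists>x. P = {x}"
      using t(2) by auto
  qed
  have less: "(\<exists>x\<in>P. \<exists>y\<in>Q. x < y) \<longleftrightarrow>
      (\<exists>t\<in>I. \<exists>x\<in>P \<inter> C t. \<exists>y\<in>Q \<inter> C t. x < y) \<or> (\<exists>s\<in>I. \<exists>t\<in>I. s < t \<and> P \<inter> C s \<noteq> {} \<and> Q \<inter> C t \<noteq> {})"
    if C: "ordered_blocks I C"
      and P: "P \<subseteq> (\<Union>t\<in>I. C t)" and Q: "Q \<subseteq> (\<Union>t\<in>I. C t)" for P Q and C :: "'i \<Rightarrow> 'x::linorder set"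
  proof
    assume "\<exists>x\<in>P. \<exists>y\<in>Q. x < y"
    then obtain x y where xy: "x \<in> P" "y \<in> Q" "x < y" by blast
    then obtain s t where st: "s \<in> I" "t \<in> I" "x \<in> C s" "y \<in> C t"
      using P Q by blast
    have "\<not> t < s"
      using ordered_blocksD[OF C, of t s y x] st xy by auto
    then consider "s = t" | "s < t" by fastforce
    then show "(\<exists>t\<in>I. \<exists>x\<in>P \<inter> C t. \<exists>y\<in>Q \<inter> C t. x < y) \<or>
        (\<exists>s\<in>I. \<exists>t\<in>I. s < t \<and> P \<inter> C s \<noteq> {} \<and> Q \<inter> C t \<noteq> {})"
      using st xy by cases blast+
  next
    assume "(\<exists>t\<in>I. \<exists>x\<in>P \<inter> C t. \<exists>y\<in>Q \<inter> C t. x < y) \<or>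
        (\<exists>s\<in>I. \<exists>t\<in>I. s < t \<and> P \<inter> C s \<noteq> {} \<and> Q \<inter> C t \<noteq> {})"
    then show "\<exists>x\<in>P. \<exists>y\<in>Q. x < y"
      using ordered_blocksD[OF C] by blast
  qed
  have e:
    "(W v \<inter> A t = {}) = (W' v \<inter> B t = {})"
    "(\<exists>x. W v \<inter> A t = {x}) = (\<exists>x. W' v \<inter> B t = {x})"
    "(W v \<inter> A t \<subseteq> W w \<inter> A t) = (W' v \<inter> B t \<subseteq> W' w \<inter> B t)"
    "(\<exists>x\<in>W v \<inter> A t. \<exists>y\<in>W w \<inter> A t. x < y) = (\<exists>x\<in>W' v \<inter> B t. \<exists>y\<in>W' w \<inter> B t. x < y)"
    if "t \<in> I" "v \<in> V" "w \<in> V" for t v w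
    using eq[OF that(1), unfolded atoms_eq_iff] that(2,3) by simp_all
  have "W v = {} \<longleftrightarrow> W' v = {}" if v: "v \<in> V" for v
    unfolding empty[OF W[OF v]] empty[OF W'[OF v]]
    by (intro ball_cong refl e(1)[OF _ v v])
  moreover have "(\<exists>x. W v = {x}) \<longleftrightarrow> (\<exists>x. W' v = {x})" if v: "v \<in> V" for v
    unfolding sing[OF A W[OF v]] sing[OF B W'[OF v]]
    by (simp only: e(1,2)[OF _ v v] cong: conj_cong ball_cong bex_cong)
  moreover have "W v \<subseteq> W w \<longleftrightarrow> W' v \<subseteq> W' w" if v: "v \<in> V" "w \<in> V" for v w
    unfolding sub[OF W[OF v(1)]] sub[OF W'[OF v(1)]]
    by (intro ball_cong refl e(3)[OF _ v])
  moreover have "(\<exists>x\<in>W v. \<exists>y\<in>W w. x < y) \<longleftrightarrow> (\<exists>x\<in>W' v. \<exists>y\<in>W' w. x < y)"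
    if v: "v \<in> V" "w \<in> V" for v w
    unfolding less[OF A W[OF v(1)] W[OF v(2)]] less[OF B W'[OF v(1)] W'[OF v(2)]]
    by (simp only: e(1)[OF _ v(1) v(1)] e(1)[OF _ v(2) v(2)] e(4)[OF _ v]
        cong: conj_cong ball_cong bex_cong)
  ultimately show ?thesis
    by (simp add: atoms_eq_iff)
qed

text \<open>The composition theorem: a move in the sum cuts into simultaneous moves of the same
  variable in all blocks, and the blockwise answers are united. No round is lost, even with
  infinitely many blocks.\<close>

lemma mso_equiv_Union:
  fixes I :: "'i::linorder set" and V :: "'v set"
  assumes A: "ordered_blocks I A"
    and B: "ordered_blocks I B"
    and "\<And>v. v \<in> V \<Longrightarrow> W v \<subseteq> (\<Union>t\<in>I. A t)" "\<And>v. v \<in> V \<Longrightarrow> W' v \<subseteq> (\<Union>t\<in>I. B t)"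
    and "\<And>t. t \<in> I \<Longrightarrow> mso_equiv V k (A t) (\<lambda>v. W v \<inter> A t) (B t) (\<lambda>v. W' v \<inter> B t)"
  shows "mso_equiv V k (\<Union>t\<in>I. A t) W (\<Union>t\<in>I. B t) W'"
  using assms(3-)
proof (induction k arbitrary: W W')
  case 0
  have "atoms V W = atoms V W'"
    by (rule atoms_Union[OF A B 0(1,2)]) (use 0(3) in auto)
  then show ?case by simp
next
  case (Suc k)
  \<comment> \<open>Gluing: disjointness of the blocks makes the union of the chosen answers
    restrict to each of them. The predicate \<open>Q\<close> stands for the block equivalence, so
    that one argument serves both directions of the game.\<close>
  have step: "\<exists>Y. Y \<subseteq> (\<Union>t\<in>I. D t) \<and>
      (\<forall>t\<in>I. Q t (\<lambda>u. (Z(v := Y)) u \<inter> D t))"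
    if D: "ordered_blocks I D"
      and ex: "\<And>t. t \<in> I \<Longrightarrow> \<exists>Y. Y \<subseteq> D t \<and> Q t ((\<lambda>u. Z u \<inter> D t)(v := Y))"
    for D :: "'i \<Rightarrow> 'x::linorder set" and Z and Q :: "'i \<Rightarrow> ('v \<Rightarrow> 'x set) \<Rightarrow> bool" and v
  proof -
    from ex obtain Y where Y: "\<And>t. t \<in> I \<Longrightarrow> Y t \<subseteq> D t"
        "\<And>t. t \<in> I \<Longrightarrow> Q t ((\<lambda>u. Z u \<inter> D t)(v := Y t))"
      by metis
    have "(\<Union>s\<in>I. Y s) \<inter> D t = Y t" if "t \<in> I" for t
      using Y(1) ordered_blocks_disjoint[OF D] that by blast
    then have "(\<lambda>u. (Z(v := (\<Union>s\<in>I. Y s))) u \<inter> D t) = (\<lambda>u. Z u \<inter> D t)(v := Y t)" if "t \<in> I" for t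
      using that by (simp add: fun_eq_iff)
    then show ?thesis
      using Y by (intro exI[of _ "\<Union>s\<in>I. Y s"]) auto
  qed
  have cut: "(\<lambda>u. Z u \<inter> C t)(v := X \<inter> C t) = (\<lambda>u. (Z(v := X)) u \<inter> C t)"
    for C :: "'i \<Rightarrow> 'x set" and Z :: "'v \<Rightarrow> 'x set" and X t v
    by (simp add: fun_eq_iff)
  have eq: "mso_equiv V (Suc k) (A t) (\<lambda>v. W v \<inter> A t) (B t) (\<lambda>v. W' v \<inter> B t)" if "t \<in> I" for t
    using Suc.prems(3) that by blast
  have at: "atoms V W = atoms V W'"
    by (rule atoms_Union[OF A B Suc.prems(1,2)]) (use mso_equiv_atoms[OF eq] in auto)
  have forward: "\<exists>Y. Y \<subseteq> (\<Union>t\<in>I. B t) \<and> mso_equiv V k (\<Union>t\<in>I. A t) (W(v := X)) (\<Union>t\<in>I. B t) (W'(v := Y))"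
    if v: "v \<in> V" and X: "X \<subseteq> (\<Union>t\<in>I. A t)" for v X
  proof -
    have "\<exists>Y. Y \<subseteq> B t \<and>
        mso_equiv V k (A t) (\<lambda>u. (W(v := X)) u \<inter> A t) (B t) ((\<lambda>u. W' u \<inter> B t)(v := Y))"
      if "t \<in> I" for t
    proof -
      from eq[OF that] v obtain Y where "Y \<subseteq> B t" "mso_equiv V k (A t)
          ((\<lambda>u. W u \<inter> A t)(v := X \<inter> A t)) (B t) ((\<lambda>u. W' u \<inter> B t)(v := Y))"
        by (rule mso_equiv_forth) (rule Int_lower2)
      then show ?thesis
        unfolding cut by (intro exI[of _ Y] conjI)
    qed
    then obtain Y where "Y \<subseteq> (\<Union>t\<in>I. B t)"
        "\<forall>t\<in>I. mso_equiv V k (A t) (\<lambda>u. (W(v := X)) u \<inter> A t) (B t) (\<lambda>u. (W'(v := Y)) u \<inter> B t)"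
      using step[OF B, of "\<lambda>t. mso_equiv V k (A t) (\<lambda>u. (W(v := X)) u \<inter> A t) (B t)"] by meson
    then show ?thesis
      using Suc.prems(1,2) X by (intro exI[of _ Y] conjI Suc.IH) auto
  qed
  have backward: "\<exists>X. X \<subseteq> (\<Union>t\<in>I. A t) \<and> mso_equiv V k (\<Union>t\<in>I. A t) (W(v := X)) (\<Union>t\<in>I. B t) (W'(v := Y))"
    if v: "v \<in> V" and Y: "Y \<subseteq> (\<Union>t\<in>I. B t)" for v Y
  proof -
    have "\<exists>X. X \<subseteq> A t \<and>
        mso_equiv V k (A t) ((\<lambda>u. W u \<inter> A t)(v := X)) (B t) (\<lambda>u. (W'(v := Y)) u \<inter> B t)"
      if "t \<in> I" for t
    proof -
      from eq[OF that] v obtain X where "X \<subseteq> A t" "mso_equiv V k (A t)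
          ((\<lambda>u. W u \<inter> A t)(v := X)) (B t) ((\<lambda>u. W' u \<inter> B t)(v := Y \<inter> B t))"
        by (rule mso_equiv_back) (rule Int_lower2)
      then show ?thesis
        unfolding cut by (intro exI[of _ X] conjI)
    qed
    then obtain X where "X \<subseteq> (\<Union>t\<in>I. A t)"
        "\<forall>t\<in>I. mso_equiv V k (A t) (\<lambda>u. (W(v := X)) u \<inter> A t) (B t) (\<lambda>u. (W'(v := Y)) u \<inter> B t)"
      using step[OF A, of "\<lambda>t Z. mso_equiv V k (A t) Z (B t) (\<lambda>u. (W'(v := Y)) u \<inter> B t)"] by meson
    then show ?thesis
      using Suc.prems(1,2) Y by (intro exI[of _ X] conjI Suc.IH) auto
  qed
  show ?case
    by (rule mso_equiv_SucI[OF at]) (rule forward backward; assumption)+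
qed

section \<open>Finiteness of the number of classes\<close>

lemma finite_mso_equiv_classes:
  assumes "finite V"
  shows "\<exists>c :: 'b::linorder set \<times> ('v \<Rightarrow> 'b set) \<Rightarrow> nat. finite (range c) \<and>
    (\<forall>A W B W'. c (A, W) = c (B, W') \<longrightarrow> mso_equiv V k A W B W')"
proof -
  \<comment> \<open>The natural type of the invariant grows with the depth; renaming its finitely
    many values by numbers keeps one type throughout the induction.\<close>
  have enc: "\<exists>c :: 'x \<Rightarrow> nat. finite (range c) \<and> (\<forall>x y. c x = c y \<longrightarrow> d x = d y)"
    if fin: "finite (range d)" for d :: "'x \<Rightarrow> 'y"
  proof -
    from finite_imp_inj_to_nat_seg[OF fin] obtain e :: "'y \<Rightarrow> nat" and n
      where "e ` range d = {i. i < n}" "inj_on e (range d)" by blast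
    then show ?thesis
      by (intro exI[of _ "\<lambda>x. e (d x)"] conjI)
        (auto simp: inj_on_def image_image intro: finite_subset[of _ "{i. i < n}"])
  qed
  have "atoms V W \<in> Pow V \<times> Pow V \<times> Pow (V \<times> V) \<times> Pow (V \<times> V)" for W :: "'v \<Rightarrow> 'b set"
    by (auto simp: atoms_def)
  then have "range (atoms V :: ('v \<Rightarrow> 'b set) \<Rightarrow> _) \<subseteq> Pow V \<times> Pow V \<times> Pow (V \<times> V) \<times> Pow (V \<times> V)"
    by (rule image_subsetI)
  then have fin_atoms: "finite (range (atoms V :: ('v \<Rightarrow> 'b set) \<Rightarrow> _))"
    by (rule finite_subset) (simp add: assms)
  show ?thesis
  proof (induction k)
    case 0
    have "finite (range (\<lambda>(A :: 'b set, W). atoms V (W :: 'v \<Rightarrow> 'b set)))"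
      by (rule finite_subset[OF _ fin_atoms]) auto
    from enc[OF this] show ?case by auto
  next
    case (Suc k)
    then obtain c :: "'b set \<times> ('v \<Rightarrow> 'b set) \<Rightarrow> nat" where c: "finite (range c)"
        "\<And>A W B W'. c (A, W) = c (B, W') \<Longrightarrow> mso_equiv V k A W B W'"
      by blast
    \<comment> \<open>The invariant of depth \<open>k + 1\<close>: the current atoms together with
      the colours of depth \<open>k\<close> reachable by reassigning each variable.\<close>
    define d where "d = (\<lambda>(A :: 'b set, W). (atoms V W, {(v, n). v \<in> V \<and> (\<exists>X\<subseteq>A. n = c (A, W(v := X)))}))"
    have "range d \<subseteq> range (atoms V :: ('v \<Rightarrow> 'b set) \<Rightarrow> _) \<times> Pow (V \<times> range c)"
      by (auto simp: d_def)
    then have "finite (range d)"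
      by (rule finite_subset) (simp add: assms fin_atoms c(1))
    from enc[OF this] obtain c' :: "'b set \<times> ('v \<Rightarrow> 'b set) \<Rightarrow> nat"
      where c': "finite (range c')" "\<And>x y. c' x = c' y \<Longrightarrow> d x = d y" by blast
    have equiv: "mso_equiv V (Suc k) A W B W'" if "d (A, W) = d (B, W')" for A W B W'
    proof -
      have "atoms V W = atoms V W'"
        using that by (simp add: d_def)
      moreover have "v \<in> V \<and> (\<exists>X\<subseteq>A. n = c (A, W(v := X))) \<longleftrightarrow>
          v \<in> V \<and> (\<exists>Y\<subseteq>B. n = c (B, W'(v := Y)))" for v n
        using that by (auto simp: d_def set_eq_iff)
      then have "(\<forall>X\<subseteq>A. \<exists>Y\<subseteq>B. c (A, W(v := X)) = c (B, W'(v := Y))) \<and>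
          (\<forall>Y\<subseteq>B. \<exists>X\<subseteq>A. c (A, W(v := X)) = c (B, W'(v := Y)))" if "v \<in> V" for v
        using that by metis
      ultimately show ?thesis
        using c(2) by (intro mso_equiv_SucI) meson+
    qed
    show ?case
      by (intro exI[of _ c'] conjI allI impI c'(1) equiv c'(2))
  qed
qed

section \<open>From games to formulas\<close>

primrec mso_depth :: "mso \<Rightarrow> nat" where
  "mso_depth (Eq i j) = 0"
| "mso_depth (Less i j) = 0"
| "mso_depth (Mem i j) = 0"
| "mso_depth (Neg f) = mso_depth f"
| "mso_depth (Conj f g) = max (mso_depth f) (mso_depth g)"
| "mso_depth (ExElem i f) = Suc (mso_depth f)"
| "mso_depth (ExSet i f) = Suc (mso_depth f)"

primrec mso_vars :: "mso \<Rightarrow> (nat + nat) set" where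
  "mso_vars (Eq i j) = {Inl i, Inl j}"
| "mso_vars (Less i j) = {Inl i, Inl j}"
| "mso_vars (Mem i j) = {Inl i, Inr j}"
| "mso_vars (Neg f) = mso_vars f"
| "mso_vars (Conj f g) = mso_vars f \<union> mso_vars g"
| "mso_vars (ExElem i f) = insert (Inl i) (mso_vars f)"
| "mso_vars (ExSet i f) = insert (Inr i) (mso_vars f)"

lemma finite_mso_vars: "finite (mso_vars f)"
  by (induction f) auto

text \<open>The game position must agree with the assignments at free variables only. For a sentence
  all variables may therefore start as the empty set, even those that stand for elements.\<close>

lemma sat_mso_equiv:
  assumes "mso_equiv V k A W B W'" "mso_vars f \<subseteq> V" "mso_depth f \<le> k"
    and "\<And>i. i \<in> free_elem f \<Longrightarrow> W (Inl i) = {u i} \<and> W' (Inl i) = {u' i}"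
    and "\<And>j. j \<in> free_set f \<Longrightarrow> W (Inr j) = U j \<and> W' (Inr j) = U' j"
  shows "sat A u U f \<longleftrightarrow> sat B u' U' f"
  using assms
proof (induction f arbitrary: k W W' u u' U U')
  case (Eq i j)
  have "W (Inl i) \<subseteq> W (Inl j) \<longleftrightarrow> W' (Inl i) \<subseteq> W' (Inl j)"
    using mso_equiv_atoms[OF Eq(1)] Eq(2) unfolding atoms_eq_iff by simp
  then show ?case
    using Eq(4) by simp
next
  case (Less i j)
  have "(\<exists>x\<in>W (Inl i). \<exists>y\<in>W (Inl j). x < y) \<longleftrightarrow> (\<exists>x\<in>W' (Inl i). \<exists>y\<in>W' (Inl j). x < y)"
    using mso_equiv_atoms[OF Less(1)] Less(2) unfolding atoms_eq_iff by simp
  then show ?case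
    using Less(4) by simp
next
  case (Mem i j)
  have "W (Inl i) \<subseteq> W (Inr j) \<longleftrightarrow> W' (Inl i) \<subseteq> W' (Inr j)"
    using mso_equiv_atoms[OF Mem(1)] Mem(2) unfolding atoms_eq_iff by simp
  then show ?case
    using Mem(4,5) by simp
next
  case (Neg f)
  then show ?case by simp
next
  case (Conj f g)
  have "sat A u U f \<longleftrightarrow> sat B u' U' f"
    by (rule Conj.IH(1)[OF Conj.prems(1)]) (use Conj.prems in auto)
  moreover have "sat A u U g \<longleftrightarrow> sat B u' U' g"
    by (rule Conj.IH(2)[OF Conj.prems(1)]) (use Conj.prems in auto)
  ultimately show ?case by simp
next
  case (ExElem i f)
  from ExElem.prems(3) obtain k' where k: "k = Suc k'" "mso_depth f \<le> k'"
    by (cases k) auto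
  have i: "Inl i \<in> V" and vars: "mso_vars f \<subseteq> V"
    using ExElem.prems(2) by auto
  have IH: "sat A (u(i := x)) U f \<longleftrightarrow> sat B (u'(i := y)) U' f"
    if "mso_equiv V k' A (W(Inl i := {x})) B (W'(Inl i := {y}))" for x y
    by (rule ExElem.IH[OF that vars k(2)]) (use ExElem.prems in auto)
  \<comment> \<open>An element move is played as a singleton, and the atoms force the answer to be a
    singleton as well.\<close>
  have sing: "(\<exists>x. X = {x}) \<longleftrightarrow> (\<exists>y. Y = {y})"
    if "mso_equiv V k' A (W(Inl i := X)) B (W'(Inl i := Y))" for X Y
    using mso_equiv_atoms[OF that] i by (fastforce simp: atoms_eq_iff)
  show ?case
  proof
    assume "sat A u U (ExElem i f)"
    then obtain x where x: "x \<in> A" "sat A (u(i := x)) U f" by auto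
    then obtain Y where "Y \<subseteq> B" and Y: "mso_equiv V k' A (W(Inl i := {x})) B (W'(Inl i := Y))"
      using ExElem.prems(1) i unfolding k mso_equiv.simps by (metis empty_subsetI insert_subset)
    moreover from sing[OF Y] obtain y where "Y = {y}" by auto
    ultimately show "sat B u' U' (ExElem i f)"
      using IH[of x y] x by auto
  next
    assume "sat B u' U' (ExElem i f)"
    then obtain y where y: "y \<in> B" "sat B (u'(i := y)) U' f" by auto
    then obtain X where "X \<subseteq> A" and X: "mso_equiv V k' A (W(Inl i := X)) B (W'(Inl i := {y}))"
      using ExElem.prems(1) i unfolding k mso_equiv.simps by (metis empty_subsetI insert_subset)
    moreover from sing[OF X] obtain x where "X = {x}" by auto
    ultimately show "sat A u U (ExElem i f)"
      using IH[of x y] y by auto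
  qed
next
  case (ExSet i f)
  from ExSet.prems(3) obtain k' where k: "k = Suc k'" "mso_depth f \<le> k'"
    by (cases k) auto
  have i: "Inr i \<in> V" and vars: "mso_vars f \<subseteq> V"
    using ExSet.prems(2) by auto
  have IH: "sat A u (U(i := X)) f \<longleftrightarrow> sat B u' (U'(i := Y)) f"
    if "mso_equiv V k' A (W(Inr i := X)) B (W'(Inr i := Y))" for X Y
    by (rule ExSet.IH[OF that vars k(2)]) (use ExSet.prems in auto)
  show ?case
    using ExSet.prems(1) i IH unfolding k mso_equiv.simps sat.simps by meson
qed

section \<open>Monadic equivalence of ordinals\<close>

definition ord_equiv :: "'v set \<Rightarrow> nat \<Rightarrow> 'a ordinal \<Rightarrow> 'a ordinal \<Rightarrow> bool" where
  "ord_equiv V k a b \<longleftrightarrow> mso_equiv V k {..<a} (\<lambda>_. {}) {..<b} (\<lambda>_. {})"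

lemma ord_equiv_refl [simp]: "ord_equiv V k a a"
  by (simp add: ord_equiv_def mso_equiv_refl)

lemma ord_equiv_sym: "ord_equiv V k a b \<Longrightarrow> ord_equiv V k b a"
  by (simp add: ord_equiv_def mso_equiv_sym)

lemma ord_equiv_trans: "ord_equiv V k a b \<Longrightarrow> ord_equiv V k b c \<Longrightarrow> ord_equiv V k a c"
  unfolding ord_equiv_def by (rule mso_equiv_trans)

lemma models_ord_equiv:
  assumes "ord_equiv (mso_vars f) (mso_depth f) a b" "sentence f"
  shows "a \<Turnstile> f \<longleftrightarrow> b \<Turnstile> f"
  unfolding models_def
  by (rule sat_mso_equiv[OF assms(1)[unfolded ord_equiv_def] order_refl order_refl])
    (use assms(2) in \<open>auto simp: sentence_def\<close>)

lemma atLeastLessThan_plus_ordinal: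
  "{a..<a + b} = (\<lambda>x. a + x) ` {..<b :: 'a::infinite ordinal}"
  by (auto simp: less_plus_ordinal_iff[of _ a b])

lemma mso_equiv_interval:
  fixes a b :: "'a::infinite ordinal"
  assumes "ord_equiv V k b b'"
  shows "mso_equiv V k {a..<a + b} (\<lambda>_. {}) {a'..<a' + b'} (\<lambda>_. {})"
proof -
  have shift: "mso_equiv V k {..<b} (\<lambda>_. {}) {a..<a + b} (\<lambda>_. {})" for a b :: "'a ordinal"
    using mso_equiv_image[of "{..<b}" "\<lambda>x. a + x" V "\<lambda>_. {}" k]
    by (simp add: atLeastLessThan_plus_ordinal strict_mono_on_def)
  show ?thesis
    by (rule mso_equiv_trans[OF mso_equiv_sym[OF shift]
          mso_equiv_trans[OF assms[unfolded ord_equiv_def] shift]])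
qed

lemma ord_equiv_plus:
  assumes "ord_equiv V k a a'" "ord_equiv V k b (b' :: 'a::infinite ordinal)"
  shows "ord_equiv V k (a + b) (a' + b')"
proof -
  define A where "A a b t = (if t then {a..<a + b} else {..<a})" for a b :: "'a ordinal" and t
  have ord: "ordered_blocks UNIV (A a b)" for a b
    by (auto simp: A_def ordered_blocks_def)
  have un: "(\<Union>t\<in>UNIV. A a b t) = {..<a + b}" for a b
    by (auto simp: A_def UNIV_bool intro: less_le_trans[OF _ le_plus_ordinal])
  have "mso_equiv V k (\<Union>t\<in>UNIV. A a b t) (\<lambda>_. {}) (\<Union>t\<in>UNIV. A a' b' t) (\<lambda>_. {})"
  proof (rule mso_equiv_Union)
    fix t
    show "mso_equiv V k (A a b t) (\<lambda>v. {} \<inter> A a b t) (A a' b' t) (\<lambda>v. {} \<inter> A a' b' t)"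
      using assms mso_equiv_interval by (cases t) (auto simp: A_def ord_equiv_def)
  qed (use ord in auto)
  then show ?thesis
    by (simp add: un ord_equiv_def)
qed

section \<open>Sums of length omega and absorption of large powers\<close>

primrec seq_sum :: "(nat \<Rightarrow> 'a::infinite ordinal) \<Rightarrow> nat \<Rightarrow> 'a ordinal" where
  "seq_sum s 0 = 0"
| "seq_sum s (Suc n) = seq_sum s n + s n"

lemma seq_sum_mono: "m \<le> n \<Longrightarrow> seq_sum s m \<le> seq_sum s n"
  by (rule lift_Suc_mono_le[of "seq_sum s"]) simp_all

text \<open>The intervals between consecutive partial sums are the blocks. The infinite sum enters
  through its predecessors, so no separate limit operation is introduced.\<close>

lemma ord_equiv_seq_sum:
  fixes L L' :: "'a::infinite ordinal"
  assumes "\<And>n. ord_equiv V k (s n) (s' n)"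
    and L: "\<And>x. x < L \<longleftrightarrow> (\<exists>n. x < seq_sum s n)"
    and L': "\<And>x. x < L' \<longleftrightarrow> (\<exists>n. x < seq_sum s' n)"
  shows "ord_equiv V k L L'"
proof -
  define A where "A s n = {seq_sum s n..<seq_sum s n + s n}" for s :: "nat \<Rightarrow> 'a ordinal" and n
  have less: "x < y" if "m < n" "x \<in> A s m" "y \<in> A s n" for s m n x y
  proof -
    have "x < seq_sum s (Suc m)"
      using that by (simp add: A_def)
    also have "\<dots> \<le> seq_sum s n"
      using that by (intro seq_sum_mono) simp
    also have "\<dots> \<le> y"
      using that by (simp add: A_def)
    finally show ?thesis .
  qed
  have ord: "ordered_blocks UNIV (A s)" for s
    unfolding ordered_blocks_def using less by blast
  have un: "(\<Union>n\<in>UNIV. A s n) = {..<L}" if L: "\<And>x. x < L \<longleftrightarrow> (\<exists>n. x < seq_sum s n)" for s and L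
  proof (intro equalityI subsetI)
    fix x assume "x \<in> (\<Union>n\<in>UNIV. A s n)"
    then obtain n where "x < seq_sum s (Suc n)"
      by (auto simp: A_def)
    with L show "x \<in> {..<L}" by blast
  next
    fix x assume "x \<in> {..<L}"
    then have ex: "\<exists>n. x < seq_sum s n"
      using L by simp
    \<comment> \<open>The least such \<open>n\<close> is a successor because the empty partial sum
      is 0; \<open>x\<close> then lies in the block before it.\<close>
    define n where "n = (LEAST n. x < seq_sum s n)"
    have n: "x < seq_sum s n"
      unfolding n_def using ex by (rule LeastI_ex)
    then obtain m where m: "n = Suc m"
      by (cases n) auto
    have "\<not> x < seq_sum s m"
      using not_less_Least[of m "\<lambda>n. x < seq_sum s n"] m by (simp add: n_def)
    with n m show "x \<in> (\<Union>n\<in>UNIV. A s n)"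
      by (auto simp: A_def not_less)
  qed
  have "mso_equiv V k (\<Union>n\<in>UNIV. A s n) (\<lambda>_. {}) (\<Union>n\<in>UNIV. A s' n) (\<lambda>_. {})"
  proof (rule mso_equiv_Union)
    fix n
    show "mso_equiv V k (A s n) (\<lambda>v. {} \<inter> A s n) (A s' n) (\<lambda>v. {} \<inter> A s' n)"
      using mso_equiv_interval[OF assms(1)] by (simp add: A_def)
  qed (use ord in auto)
  then show ?thesis
    by (simp add: un[OF L] un[OF L'] ord_equiv_def)
qed

lemma seq_sum_const: "seq_sum (\<lambda>_. a) n = a * fin_ord n"
  by (induction n) (simp_all add: times_succ_ordinal)

lemma ord_equiv_times_omega:
  assumes "ord_equiv V k a (b :: 'a::infinite ordinal)"
  shows "ord_equiv V k (a * omega) (b * omega)"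
  by (rule ord_equiv_seq_sum[of V k "\<lambda>_. a" "\<lambda>_. b"])
    (simp_all add: assms seq_sum_const less_times_omega_iff)

text \<open>Every exponent in \<open>{p..<c}\<close> is repeated infinitely often, so successors and limits \<open>c\<close>
  are treated alike.\<close>

lemma omega_pow_eq_seq_sum:
  fixes p c :: "'a::infinite ordinal"
  assumes "countable {..<c}" "p < c"
  shows "\<exists>s. (\<forall>n. p \<le> s n \<and> s n < c) \<and>
    (\<forall>x. x < omega_pow c \<longleftrightarrow> (\<exists>n. x < seq_sum (\<lambda>n. omega_pow (s n)) n))"
proof -
  define g where "g = from_nat_into {p..<c}"
  have "countable {p..<c}"
    by (rule countable_subset[OF _ assms(1)]) auto
  then have g: "range g = {p..<c}"
    unfolding g_def using assms(2) by (intro range_from_nat_into) auto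
  define s where "s n = g (fst (prod_decode n))" for n
  have s: "p \<le> s n \<and> s n < c" for n
    using g unfolding s_def by (metis atLeastLessThan_iff rangeI)
  let ?S = "seq_sum (\<lambda>n. omega_pow (s n))"
  have large: "\<exists>n. omega_pow b * fin_ord j \<le> ?S n" if b: "p \<le> b" "b < c" for b j
  proof (induction j)
    case 0
    then show ?case by simp
  next
    case (Suc j)
    then obtain n where n: "omega_pow b * fin_ord j \<le> ?S n" ..
    from b g obtain i where i: "b = g i"
      by (metis atLeastLessThan_iff rangeE)
    \<comment> \<open>The pairing function places a copy of the exponent \<open>g i\<close> at a
      position not before \<open>n\<close>, so one more copy can always be collected.\<close>
    let ?m = "prod_encode (i, n)"
    have "?S n \<le> ?S ?m"
      by (intro seq_sum_mono le_prod_encode_2)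
    with n have "omega_pow b * fin_ord (Suc j) \<le> ?S ?m + omega_pow b"
      by (simp add: times_succ_ordinal plus_ordinal_mono)
    also have "\<dots> = ?S (Suc ?m)"
      by (simp add: s_def i)
    finally show ?case ..
  qed
  have "x < omega_pow c \<longleftrightarrow> (\<exists>n. x < ?S n)" for x
  proof
    assume "x < omega_pow c"
    then consider "x = 0" | b n where "b < c" "x < omega_pow b * fin_ord n"
      by (auto simp: less_omega_pow_iff[of x c])
    then show "\<exists>n. x < ?S n"
    proof cases
      case 1
      then have "x < ?S (Suc 0)" by simp
      then show ?thesis ..
    next
      case 2
      \<comment> \<open>Exponents below \<open>p\<close> do not occur in the sequence; they are
        raised to \<open>p\<close>, which is still below \<open>c\<close>.\<close>
      have "b \<le> max p b" by simp
      with 2(2) obtain m where "x < omega_pow (max p b) * fin_ord m"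
        by (rule less_omega_pow_times_fin_mono)
      moreover obtain k where "omega_pow (max p b) * fin_ord m \<le> ?S k"
        using large[of "max p b" m] assms(2) 2(1) by auto
      ultimately show ?thesis
        using less_le_trans by blast
    qed
  next
    have "?S n < omega_pow c" for n
      by (induction n) (auto intro: omega_pow_plus_closed simp: s)
    then show "\<exists>n. x < ?S n \<Longrightarrow> x < omega_pow c"
      using less_trans by blast
  qed
  then show ?thesis
    by (intro exI[of _ s] conjI allI) (auto simp: s)
qed

text \<open>
  Pigeonhole gives finite \<open>a < b\<close> with \<open>\<omega>\<^sup>a\<close> equivalent to \<open>\<omega>\<^sup>b\<close>. Then, with \<open>m = a + 1 \<le> b\<close>,
  \<open>\<omega>\<close> copies of \<open>\<omega>\<^sup>a + \<omega>\<^sup>m = \<omega>\<^sup>m\<close> give \<open>\<omega>\<^bsup>a+2\<^esup>\<close>, while \<open>\<omega>\<close> copies of \<open>\<omega>\<^sup>b + \<omega>\<^sup>m\<close> give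
  \<open>\<omega>\<^bsup>b+1\<^esup>\<close>, which is equivalent to \<open>\<omega>\<^bsup>a+1\<^esup>\<close>.
\<close>

lemma ex_omega_pow_equiv_succ:
  fixes V :: "'v set"
  assumes "finite V"
  obtains p where "ord_equiv V k (omega_pow (fin_ord p)) (omega_pow (fin_ord (Suc p)) :: 'a::infinite ordinal)"
proof -
  obtain c :: "'a ordinal set \<times> ('v \<Rightarrow> 'a ordinal set) \<Rightarrow> nat" where c: "finite (range c)"
      "\<And>A W B W'. c (A, W) = c (B, W') \<Longrightarrow> mso_equiv V k A W B W'"
    using finite_mso_equiv_classes[OF assms] by blast
  define f where "f n = c ({..<omega_pow (fin_ord n)}, \<lambda>_. {})" for n
  have "finite (range f)"
    by (rule finite_subset[OF _ c(1)]) (auto simp: f_def)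
  then have "\<not> inj f"
    using finite_imageD infinite_UNIV_nat by blast
  then obtain a b where ab: "a < b" "f a = f b"
    unfolding inj_def by (metis linorder_neqE_nat)
  then have eq: "ord_equiv V k (omega_pow (fin_ord a)) (omega_pow (fin_ord b) :: 'a ordinal)"
    using c(2) by (simp add: f_def ord_equiv_def)
  let ?a = "fin_ord a :: 'a ordinal" and ?b = "fin_ord b :: 'a ordinal"
    and ?m = "fin_ord (Suc a) :: 'a ordinal"
  have "?m \<le> ?b"
    using ab by (metis Suc_leI fin_ord_less_iff le_less not_less)
  have "(omega_pow ?a + omega_pow ?m) * omega = omega_pow (fin_ord (Suc (Suc a)))"
    using omega_pow_absorb[of "omega_pow ?a" ?m]
    by (simp add: less_ord_succ_iff flip: omega_pow_succ)
  moreover have "(omega_pow ?b + omega_pow ?m) * omega = omega_pow (ord_succ ?b)"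
    by (rule omega_pow_plus_times_omega[OF \<open>?m \<le> ?b\<close>])
  ultimately have "ord_equiv V k (omega_pow (fin_ord (Suc (Suc a)))) (omega_pow (ord_succ ?b))"
    using ord_equiv_times_omega[OF ord_equiv_plus[OF eq ord_equiv_refl[of V k "omega_pow ?m"]]]
    by simp
  moreover have "ord_equiv V k (omega_pow (ord_succ ?a)) (omega_pow (ord_succ ?b))"
    unfolding omega_pow_succ by (rule ord_equiv_times_omega[OF eq])
  ultimately have "ord_equiv V k (omega_pow (fin_ord (Suc a))) (omega_pow (fin_ord (Suc (Suc a))) :: 'a ordinal)"
    by (metis fin_ord_Suc ord_equiv_sym ord_equiv_trans)
  with that show ?thesis .
qed

text \<open>By induction each term of the sequence summing to \<open>omega_pow c\<close> may be
  replaced by \<open>omega_pow p\<close>; the result is \<open>omega_pow p * omega\<close>, the next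
  power, which is equivalent to \<open>omega_pow p\<close> by assumption.\<close>

lemma omega_pow_equiv:
  fixes p c :: "'a::infinite ordinal"
  assumes p: "ord_equiv V k (omega_pow p) (omega_pow (ord_succ p))"
    and "p \<le> c" "countable {..<c}"
  shows "ord_equiv V k (omega_pow c) (omega_pow p)"
  using assms(2,3)
proof (induction c rule: less_induct)
  case (less c)
  show ?case
  proof (cases "c = p")
    case False
    with less.prems have "p < c" by simp
    from omega_pow_eq_seq_sum[OF less.prems(2) this] obtain s where s: "\<And>n. p \<le> s n \<and> s n < c"
        "\<And>x. x < omega_pow c \<longleftrightarrow> (\<exists>n. x < seq_sum (\<lambda>n. omega_pow (s n)) n)"
      by metis
    have "ord_equiv V k (omega_pow (s n)) (omega_pow p)" for n
    proof (rule less.IH)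
      show "countable {..<s n}"
        by (rule countable_subset[OF _ less.prems(2)]) (use s(1) in \<open>auto intro: less_imp_le\<close>)
    qed (use s(1) in auto)
    then have "ord_equiv V k (omega_pow c) (omega_pow p * omega)"
      by (rule ord_equiv_seq_sum[OF _ s(2)]) (simp add: seq_sum_const less_times_omega_iff)
    then show ?thesis
      using p ord_equiv_sym ord_equiv_trans unfolding omega_pow_succ by blast
  qed simp
qed

lemma omega_sum_equiv:
  fixes p :: "'a::infinite ordinal"
  assumes p: "ord_equiv V k (omega_pow p) (omega_pow (ord_succ p))"
    and "as \<noteq> []" "\<And>a. a \<in> set as \<Longrightarrow> p \<le> a \<and> countable {..<a}"
  shows "ord_equiv V k (omega_sum as) (omega_pow p)"
  using assms(2,3)
proof (induction as)
  case (Cons a as)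
  have a: "ord_equiv V k (omega_pow a) (omega_pow p)"
    using Cons.prems by (intro omega_pow_equiv[OF p]) auto
  \<comment> \<open>Replacing the second summand by the next power lets it absorb the first, so two
    copies collapse to one.\<close>
  have "ord_equiv V k (omega_pow p + omega_pow p) (omega_pow p + omega_pow (ord_succ p))"
    by (intro ord_equiv_plus ord_equiv_refl p)
  then have pp: "ord_equiv V k (omega_pow p + omega_pow p) (omega_pow p)"
    using p ord_equiv_sym ord_equiv_trans
    by (metis less_ord_succ_iff omega_pow_absorb omega_pow_less_iff order_refl)
  show ?case
  proof (cases "as = []")
    case False
    then have "ord_equiv V k (omega_sum as) (omega_pow p)"
      using Cons by auto
    from ord_equiv_trans[OF ord_equiv_plus[OF a this] pp] show ?thesis
      by simp
  qed (use a in simp)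
qed simp

section \<open>Normal forms as multisets of exponents, split at a threshold\<close>

lemma nonincreasing_split:
  assumes "nonincreasing as"
  shows "as = filter (\<lambda>a. \<not> a < p) as @ filter (\<lambda>a. a < p) as"
  using assms
proof (induction as)
  case (Cons a as)
  then have IH: "as = filter (\<lambda>a. \<not> a < p) as @ filter (\<lambda>a. a < p) as"
    by (simp add: nonincreasing_def)
  show ?case
  proof (cases "a < p")
    case True
    then have "\<forall>b\<in>set as. b < p"
      using Cons.prems by (auto simp: nonincreasing_def)
    with True show ?thesis
      by (auto simp: filter_empty_conv filter_id_conv)
  qed (use IH in simp)
qed simp

text \<open>Under this encoding the norm becomes an additive weight, and separating high from low
  terms becomes filtering.\<close>

definition mset_ordinal :: "'a::infinite ordinal multiset \<Rightarrow> 'a ordinal" where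
  "mset_ordinal M = omega_sum (rev (sorted_list_of_multiset M))"

lemma nonincreasing_rev_sorted_list: "nonincreasing (rev (sorted_list_of_multiset M))"
  by (simp add: nonincreasing_iff_sorted_rev)

lemma rev_sorted_list_filter_mset:
  "rev (sorted_list_of_multiset (filter_mset P M)) = filter P (rev (sorted_list_of_multiset M))"
proof -
  let ?xs = "sorted_list_of_multiset M"
  have "sorted (filter P ?xs)"
    by (intro sorted_wrt_filter sorted_sorted_list_of_multiset)
  then have "sorted_list_of_multiset (mset (filter P ?xs)) = filter P ?xs"
    by (simp only: sorted_list_of_multiset_mset sorted_sort_id)
  then have "sorted_list_of_multiset (filter_mset P M) = filter P ?xs"
    by (simp only: mset_filter mset_sorted_list_of_multiset)
  then show ?thesis
    by (simp add: rev_filter)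
qed

lemma mset_ordinal_equiv:
  fixes p :: "'a::infinite ordinal"
  assumes p: "ord_equiv V k (omega_pow p) (omega_pow (ord_succ p))"
    and "filter_mset (\<lambda>a. \<not> a < p) M \<noteq> {#}" "\<And>a. a \<in># M \<Longrightarrow> countable {..<a}"
  shows "ord_equiv V k (mset_ordinal M) (omega_pow p + mset_ordinal (filter_mset (\<lambda>a. a < p) M))"
proof -
  let ?as = "rev (sorted_list_of_multiset M)"
  let ?hi = "filter (\<lambda>a. \<not> a < p) ?as"
  have set: "set ?as = set_mset M" by simp
  have "mset ?hi = filter_mset (\<lambda>a. \<not> a < p) M"
    by (simp only: mset_filter mset_rev mset_sorted_list_of_multiset)
  with assms(2) have "?hi \<noteq> []"
    by (metis mset.simps(1))
  then have "ord_equiv V k (omega_sum ?hi) (omega_pow p)"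
    by (rule omega_sum_equiv[OF p]) (use assms(3) in \<open>auto simp: not_less\<close>)
  then have "ord_equiv V k (omega_sum ?hi + omega_sum (filter (\<lambda>a. a < p) ?as))
      (omega_pow p + omega_sum (filter (\<lambda>a. a < p) ?as))"
    by (intro ord_equiv_plus ord_equiv_refl)
  then show ?thesis
    unfolding mset_ordinal_def rev_sorted_list_filter_mset omega_sum_append[symmetric]
      nonincreasing_split[OF nonincreasing_rev_sorted_list, symmetric] .
qed

section \<open>Counting multisets by weight\<close>

definition weight :: "('e \<Rightarrow> nat) \<Rightarrow> 'e multiset \<Rightarrow> nat" where
  "weight w M = (\<Sum>a\<in>#M. w a)"

definition msets :: "'e set \<Rightarrow> ('e \<Rightarrow> nat) \<Rightarrow> nat \<Rightarrow> 'e multiset set" where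
  "msets S w n = {M. set_mset M \<subseteq> S \<and> weight w M = n}"

lemma weight_simps [simp]:
  "weight w {#} = 0" "weight w (add_mset a M) = w a + weight w M"
  "weight w (M + M') = weight w M + weight w M'"
  by (simp_all add: weight_def)

lemma size_le_weight:
  assumes "\<And>a. a \<in># M \<Longrightarrow> 1 \<le> w a"
  shows "size M \<le> weight w M"
  using assms
proof (induction M)
  case (add a M)
  then have "size M \<le> weight w M" "1 \<le> w a" by auto
  then show ?case by simp
qed simp

lemma finite_msets_mono: "finite (msets T w n) \<Longrightarrow> S \<subseteq> T \<Longrightarrow> finite (msets S w n)"
  by (rule finite_subset) (auto simp: msets_def)

text \<open>Deleting one copy of \<open>a\<close> is a bijection from the multisets containing
  \<open>a\<close>. In generating functions this is the factor 1 / (1 - x^(w a)).\<close>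

lemma card_msets_insert:
  assumes "a \<notin> S" and fin: "\<And>n. finite (msets (insert a S) w n)"
  shows "card (msets (insert a S) w n) =
    card (msets S w n) + (if w a \<le> n then card (msets (insert a S) w (n - w a)) else 0)"
proof -
  let ?T = "{M \<in> msets (insert a S) w n. a \<in># M}"
  have "msets (insert a S) w n = msets S w n \<union> ?T" "msets S w n \<inter> ?T = {}"
    using assms(1) by (auto simp: msets_def)
  then have "card (msets (insert a S) w n) = card (msets S w n) + card ?T"
    using fin[of n] by (metis card_Un_disjoint finite_Un)
  moreover have "card ?T = (if w a \<le> n then card (msets (insert a S) w (n - w a)) else 0)"
  proof (cases "w a \<le> n")
    case True
    have "?T = add_mset a ` msets (insert a S) w (n - w a)"
    proof (intro equalityI subsetI)
      fix M assume M: "M \<in> ?T"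
      then obtain M' where M': "M = add_mset a M'"
        by (auto dest: multi_member_split)
      with M have "M' \<in> msets (insert a S) w (n - w a)"
        by (auto simp: msets_def)
      with M' show "M \<in> add_mset a ` msets (insert a S) w (n - w a)" by blast
    qed (use True in \<open>auto simp: msets_def\<close>)
    then show ?thesis
      using True by (simp add: card_image inj_on_def)
  next
    case False
    then have "?T = {}"
      by (auto simp: msets_def dest!: multi_member_split)
    with False show ?thesis by (simp only: if_False card.empty)
  qed
  ultimately show ?thesis by simp
qed

text \<open>A multiset over \<open>F\<close> is determined by its multiplicities there, each at most
  its weight.\<close>

lemma card_msets_finite_le:
  assumes "finite F" "\<And>a. a \<in> F \<Longrightarrow> 1 \<le> w a"
  shows "card (msets F w n) \<le> (n + 1) ^ card F"
proof -
  let ?g = "\<lambda>M. restrict (count M) F"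
  have "inj_on ?g (msets F w n)"
  proof (rule inj_onI)
    fix M M' assume M: "M \<in> msets F w n" "M' \<in> msets F w n" and eq: "?g M = ?g M'"
    show "M = M'"
    proof (rule multiset_eqI)
      fix a
      show "count M a = count M' a"
      proof (cases "a \<in> F")
        case True
        with eq show ?thesis by (metis restrict_apply)
      next
        case False
        with M have "a \<notin># M" "a \<notin># M'"
          by (auto simp: msets_def)
        then show ?thesis by (simp add: not_in_iff)
      qed
    qed
  qed
  moreover have "?g ` msets F w n \<subseteq> F \<rightarrow>\<^sub>E {..n}"
  proof (rule image_subsetI)
    fix M assume M: "M \<in> msets F w n"
    have "count M a \<le> n" for a
    proof -
      have "count M a \<le> size M" by (rule count_le_size)
      also have "\<dots> \<le> weight w M"
        using M assms(2) by (intro size_le_weight) (auto simp: msets_def)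
      finally show ?thesis
        using M by (simp add: msets_def)
    qed
    then show "?g M \<in> F \<rightarrow>\<^sub>E {..n}" by auto
  qed
  moreover have "finite (F \<rightarrow>\<^sub>E {..n})"
    using assms(1) by (intro finite_PiE) auto
  ultimately have "card (msets F w n) \<le> card (F \<rightarrow>\<^sub>E {..n})"
    by (rule card_inj_on_le)
  also have "\<dots> = (n + 1) ^ card F"
    using assms(1) by (simp add: card_PiE)
  finally show ?thesis .
qed

section \<open>Asymptotics of the counting function\<close>

lemma summable_poly_times_power:
  fixes r :: real
  assumes "0 < r" "r < 1"
  shows "summable (\<lambda>n. (real n + 1) ^ d * r ^ n)"
proof -
  obtain s where s: "r < s" "s < 1"
    using dense[OF assms(2)] by blast
  have "(\<lambda>n. 1 / (real n + 1)) \<longlonglongrightarrow> 0"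
    using LIMSEQ_inverse_real_of_nat by (simp add: inverse_eq_divide add.commute)
  then have "(\<lambda>n. (1 + 1 / (real n + 1)) ^ d * r) \<longlonglongrightarrow> (1 + 0) ^ d * r"
    by (intro tendsto_mult tendsto_power tendsto_add tendsto_const)
  then have "eventually (\<lambda>n. (1 + 1 / (real n + 1)) ^ d * r < s) sequentially"
    using s(1) by (intro order_tendstoD(2)) auto
  then obtain n0 where n0: "\<And>n. n \<ge> n0 \<Longrightarrow> (1 + 1 / (real n + 1)) ^ d * r < s"
    by (auto simp: eventually_sequentially)
  show ?thesis
  proof (rule summable_ratio_test[OF s(2)])
    fix n assume n: "n \<ge> n0"
    have "real (Suc n) + 1 = (1 + 1 / (real n + 1)) * (real n + 1)"
      by (simp add: field_simps)
    then have "(real (Suc n) + 1) ^ d * r ^ Suc n =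
        ((1 + 1 / (real n + 1)) ^ d * r) * ((real n + 1) ^ d * r ^ n)"
      by (simp add: power_mult_distrib)
    also have "\<dots> \<le> s * ((real n + 1) ^ d * r ^ n)"
      using n0[OF n] assms(1) by (intro mult_right_mono) auto
    finally show "norm ((real (Suc n) + 1) ^ d * r ^ Suc n) \<le> s * norm ((real n + 1) ^ d * r ^ n)"
      using assms(1) by (simp add: abs_mult)
  qed
qed

text \<open>A telescoping product of \<open>j\<close> consecutive ratios. Truncated subtraction
  affects only the terms with \<open>n < j\<close>.\<close>

lemma tendsto_shifted_ratio:
  fixes c :: "nat \<Rightarrow> real"
  assumes pos: "\<And>n. c n > 0" and lim: "(\<lambda>n. c n / c (n + 1)) \<longlonglongrightarrow> \<rho>"
  shows "(\<lambda>n. c (n - j) / c n) \<longlonglongrightarrow> \<rho> ^ j"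
proof -
  have nz [simp]: "c n \<noteq> 0" for n
    using pos[of n] by simp
  have "(\<lambda>n. c n / c (n + j)) \<longlonglongrightarrow> \<rho> ^ j"
  proof (induction j)
    case 0
    show ?case by simp
  next
    case (Suc j)
    have "(\<lambda>n. c (n + j) / c (n + j + 1)) \<longlonglongrightarrow> \<rho>"
      using LIMSEQ_ignore_initial_segment[OF lim, of j] by simp
    from tendsto_mult[OF Suc.IH this] have "(\<lambda>n. c n / c (n + j) * (c (n + j) / c (n + j + 1))) \<longlonglongrightarrow> \<rho> ^ Suc j"
      by (simp add: mult.commute)
    moreover have "c n / c (n + j) * (c (n + j) / c (n + j + 1)) = c n / c (n + Suc j)" for n
      by simp
    ultimately show ?case by simp
  qed
  then show ?thesis
    using LIMSEQ_offset[of "\<lambda>n. c (n - j) / c n" j] by simp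
qed

text \<open>For \<open>r\<close> strictly between \<open>max \<rho> 0\<close> and 1, the sequence
  \<open>c n * r ^ n\<close> is eventually nondecreasing, and the initial segment costs a constant
  factor. The bound is uniform in \<open>n\<close> and \<open>j\<close>, as a dominating series
  requires.\<close>

lemma ratio_geometric_bound:
  fixes c :: "nat \<Rightarrow> real"
  assumes pos: "\<And>n. c n > 0" and lim: "(\<lambda>n. c n / c (n + 1)) \<longlonglongrightarrow> \<rho>" and "\<rho> < 1"
  obtains r C where "0 < r" "r < 1" "0 \<le> C" "\<And>n j. j \<le> n \<Longrightarrow> c (n - j) \<le> C * r ^ j * c n"
proof -
  obtain r where r: "max \<rho> 0 < r" "r < 1"
    using dense[of "max \<rho> 0" 1] assms(3) by auto
  have "eventually (\<lambda>n. c n / c (n + 1) < r) sequentially"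
    using order_tendstoD(2)[OF lim, of r] r(1) by simp
  then obtain n0 where lt: "\<And>n. n \<ge> n0 \<Longrightarrow> c n / c (n + 1) < r"
    by (auto simp: eventually_sequentially)
  have n0: "c n \<le> r * c (n + 1)" if "n \<ge> n0" for n
    using lt[OF that] by (simp only: pos_divide_less_eq[OF pos] less_imp_le)
  define g where "g n = c n * r ^ n" for n
  have gpos: "g n > 0" for n
    using pos r(1) by (simp add: g_def)
  have step: "g n \<le> g (Suc n)" if "n \<ge> n0" for n
    using mult_right_mono[OF n0[OF that], of "r ^ n"] r(1) by (simp add: g_def mult_ac)
  have mono: "g m \<le> g n" if "n0 \<le> m" "m \<le> n" for m n
    using that(2)
  proof (induction n rule: dec_induct)
    case (step n)
    then show ?case
      using \<open>\<And>n. n \<ge> n0 \<Longrightarrow> g n \<le> g (Suc n)\<close>[of n] that(1) by simp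
  qed simp
  define D where "D = Max (g ` {..n0})"
  define d where "d = Min (g ` {..n0})"
  have D: "g m \<le> D" if "m \<le> n0" for m
    unfolding D_def using that by (intro Max_ge) auto
  have d: "d \<le> g m" if "m \<le> n0" for m
    unfolding d_def using that by (intro Min_le) auto
  have "d > 0"
    unfolding d_def using gpos by (subst Min_gr_iff) auto
  have "d \<le> D"
    using D[of 0] d[of 0] by simp
  \<comment> \<open>\<open>D\<close> bounds the initial values from above. \<open>d\<close> bounds
    all values from below, since beyond \<open>n0\<close> they are at least \<open>g n0\<close>; the
    quotient covers comparisons that start in the initial segment.\<close>
  define C where "C = D / d"
  have C: "1 \<le> C" "C * d = D"
    using \<open>d > 0\<close> \<open>d \<le> D\<close> by (simp_all add: C_def)
  have bound: "g m \<le> C * g n" if "m \<le> n" for m n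
  proof (cases "n0 \<le> m")
    case True
    then have "g m \<le> 1 * g n"
      using mono that by simp
    also have "\<dots> \<le> C * g n"
      using C(1) gpos[of n] by (intro mult_right_mono) auto
    finally show ?thesis .
  next
    case False
    have "d \<le> g n"
    proof (cases "n \<le> n0")
      case False
      then show ?thesis
        using d[of n0] mono[of n0 n] by simp
    qed (rule d)
    then have "C * d \<le> C * g n"
      using C(1) by (intro mult_left_mono) auto
    then show ?thesis
      using D[of m] False C(2) by simp
  qed
  have "c (n - j) \<le> C * r ^ j * c n" if "j \<le> n" for n j
  proof -
    have "r ^ n = r ^ j * r ^ (n - j)"
      using that by (simp flip: power_add)
    then have "c (n - j) * r ^ (n - j) \<le> (C * r ^ j * c n) * r ^ (n - j)"
      using bound[of "n - j" n] by (simp add: g_def mult_ac)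
    then show ?thesis
      using r(1) by (simp add: mult_le_cancel_right_pos)
  qed
  with that[of r C] r C(1) show ?thesis by simp
qed

text \<open>Removing one prime \<open>a\<close> replaces the count \<open>h n\<close> by
  \<open>h n - h (n - w a)\<close>, which multiplies the limit by
  \<open>1 - \<rho> ^ w a\<close>.\<close>

lemma convergent_card_msets_ratio:
  assumes fin: "\<And>n. finite (msets E w n)" and pos: "\<And>n. card (msets E w n) > 0"
    and lim: "(\<lambda>n. real (card (msets E w n)) / real (card (msets E w (n + 1)))) \<longlonglongrightarrow> \<rho>"
    and "finite F" "F \<subseteq> E"
  shows "\<exists>K. (\<lambda>n. real (card (msets (E - F) w n)) / real (card (msets E w n))) \<longlonglongrightarrow> K"
  using assms(4,5)
proof (induction F rule: finite_induct)
  case empty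
  have "real (card (msets E w n)) / real (card (msets E w n)) = 1" for n
    using pos[of n] by (intro divide_self) simp
  then show ?case
    by (intro exI[of _ 1]) simp
next
  case (insert a F)
  let ?c = "\<lambda>n. real (card (msets E w n))" and ?h = "\<lambda>n. real (card (msets (E - F) w n))"
    and ?h' = "\<lambda>n. real (card (msets (E - insert a F) w n))"
  from insert obtain K where K: "(\<lambda>n. ?h n / ?c n) \<longlonglongrightarrow> K" by auto
  have ins: "insert a (E - insert a F) = E - F"
    using insert by auto
  have "card (msets (E - F) w n) = card (msets (E - insert a F) w n) +
      (if w a \<le> n then card (msets (E - F) w (n - w a)) else 0)" for n
    unfolding ins[symmetric]
    by (rule card_msets_insert) (auto simp: ins intro: finite_msets_mono[OF fin])
  then have rec: "?h' n = ?h n - ?h (n - w a)" if "w a \<le> n" for n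
    using that by simp
  \<comment> \<open>The limit is taken along \<open>n + w a\<close>, where the recurrence holds
    without truncated subtraction.\<close>
  have "(\<lambda>n. ?h n / ?c n * (?c n / ?c (n + w a))) \<longlonglongrightarrow> K * \<rho> ^ w a"
    using LIMSEQ_ignore_initial_segment[OF tendsto_shifted_ratio[OF _ lim], of "w a" "w a"] pos
    by (intro tendsto_mult K) auto
  moreover have "?h n / ?c n * (?c n / ?c (n + w a)) = ?h n / ?c (n + w a)" for n
    using pos[of n] by simp
  ultimately have "(\<lambda>n. ?h n / ?c (n + w a)) \<longlonglongrightarrow> K * \<rho> ^ w a"
    by (simp only:)
  then have "(\<lambda>n. ?h (n + w a) / ?c (n + w a) - ?h n / ?c (n + w a)) \<longlonglongrightarrow> K - K * \<rho> ^ w a"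
    using LIMSEQ_ignore_initial_segment[OF K, of "w a"] by (intro tendsto_diff) auto
  then have "(\<lambda>n. ?h' (n + w a) / ?c (n + w a)) \<longlonglongrightarrow> K - K * \<rho> ^ w a"
    by (simp add: rec diff_divide_distrib)
  from LIMSEQ_offset[of "\<lambda>n. ?h' n / ?c n" "w a", OF this] show ?case ..
qed

text \<open>Once the part outside \<open>F\<close> is nonempty, \<open>P\<close> is decided by the
  part in \<open>F\<close> alone, so the two parts vary independently. Multisets entirely over
  \<open>F\<close> are counted separately, hence the removal of \<open>{#}\<close>.\<close>

lemma card_msets_split:
  assumes fin: "\<And>n. finite (msets E w n)" and "F \<subseteq> E"
    and PQ: "\<And>M. set_mset M \<subseteq> E \<Longrightarrow> {#a \<in># M. a \<notin> F#} \<noteq> {#} \<Longrightarrow> P M \<longleftrightarrow> Q {#a \<in># M. a \<in> F#}"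
  shows "card {M \<in> msets E w n. P M} = card {M \<in> msets F w n. P M} +
    (\<Sum>j\<le>n. card {L \<in> msets F w j. Q L} * card (msets (E - F) w (n - j) - {{#}}))"
proof -
  let ?lo = "\<lambda>M. {#a \<in># M. a \<in> F#}" and ?hi = "\<lambda>M. {#a \<in># M. a \<notin> F#}"
  let ?A = "{M \<in> msets E w n. P M \<and> ?hi M \<noteq> {#}}"
  let ?B = "SIGMA j:{..n}. {L \<in> msets F w j. Q L} \<times> (msets (E - F) w (n - j) - {{#}})"
  have sub: "set_mset M \<subseteq> F \<longleftrightarrow> ?hi M = {#}" for M
    by (auto simp: filter_mset_eq_mempty_iff)
  have union: "{M \<in> msets E w n. P M} = {M \<in> msets F w n. P M} \<union> ?A"
    and disjoint: "{M \<in> msets F w n. P M} \<inter> ?A = {}"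
    using assms(2) by (auto simp: msets_def sub[symmetric])
  have "finite {M \<in> msets F w n. P M}" "finite ?A"
    using fin finite_msets_mono[OF fin assms(2)] by auto
  then have "card {M \<in> msets E w n. P M} = card {M \<in> msets F w n. P M} + card ?A"
    by (subst union) (rule card_Un_disjoint[OF _ _ disjoint])
  \<comment> \<open>The weight of the low part is recorded as a first component to make the target a
    disjoint union matching the convolution.\<close>
  moreover have "bij_betw (\<lambda>M. (weight w (?lo M), ?lo M, ?hi M)) ?A ?B"
  proof (rule bij_betw_byWitness[where f' = "\<lambda>(j, L, H). L + H"])
    have part: "?lo M + ?hi M = M" for M
      by (rule multiset_partition[symmetric])
    then show "\<forall>M\<in>?A. (\<lambda>(j, L, H). L + H) (weight w (?lo M), ?lo M, ?hi M) = M"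
      by simp
    have LH: "?lo (L + H) = L" "?hi (L + H) = H"
      if "L \<in> msets F w j" "H \<in> msets (E - F) w k" for L H j k
    proof -
      have "?lo L = L" "?hi L = {#}" if "set_mset L \<subseteq> F" for L
        using that by (induction L) auto
      moreover have "?lo H = {#}" "?hi H = H" if "set_mset H \<subseteq> E - F" for H
        using that by (induction H) auto
      ultimately show "?lo (L + H) = L" "?hi (L + H) = H"
        using that by (auto simp: msets_def)
    qed
    then show "\<forall>x\<in>?B. (\<lambda>M. (weight w (?lo M), ?lo M, ?hi M)) ((\<lambda>(j, L, H). L + H) x) = x"
      by (auto simp: msets_def)
    show "(\<lambda>M. (weight w (?lo M), ?lo M, ?hi M)) ` ?A \<subseteq> ?B"
    proof (rule image_subsetI)
      fix M assume M: "M \<in> ?A"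
      have "weight w (?lo M) + weight w (?hi M) = n"
        using M part[of M] by (auto simp: msets_def simp flip: weight_simps(3))
      moreover have "Q (?lo M)"
        using M PQ by (auto simp: msets_def)
      ultimately show "(weight w (?lo M), ?lo M, ?hi M) \<in> ?B"
        using M by (auto simp: msets_def)
    qed
    show "(\<lambda>(j, L, H). L + H) ` ?B \<subseteq> ?A"
    proof (rule image_subsetI)
      fix x assume "x \<in> ?B"
      then obtain j L H where x: "x = (j, L, H)" "j \<le> n" "L \<in> msets F w j" "Q L"
          "H \<in> msets (E - F) w (n - j)" "H \<noteq> {#}"
        by auto
      have sub: "set_mset (L + H) \<subseteq> E"
        using x(3,5) assms(2) by (auto simp: msets_def)
      have hi: "?hi (L + H) \<noteq> {#}"
        using LH(2)[OF x(3,5)] x(6) by (simp only: not_False_eq_True)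
      have "P (L + H)"
        using PQ[OF sub hi] LH(1)[OF x(3,5)] x(4) by (simp only:)
      moreover have "L + H \<in> msets E w n"
        using sub x(2,3,5) by (simp add: msets_def)
      ultimately show "(\<lambda>(j, L, H). L + H) x \<in> ?A"
        using hi unfolding x(1) prod.case mem_Collect_eq by (intro conjI)
    qed
  qed
  then have "card ?A = card ?B"
    by (rule bij_betw_same_card)
  moreover have "card ?B = (\<Sum>j\<le>n. card {L \<in> msets F w j. Q L} * card (msets (E - F) w (n - j) - {{#}}))"
    using finite_msets_mono[OF fin assms(2)] finite_msets_mono[OF fin, of "E - F"]
    by (subst card_SigmaI) (auto simp: card_cartesian_product)
  ultimately show ?thesis by simp
qed

text \<open>
  Removing the finitely many primes in \<open>F\<close> multiplies the counting function asymptotically by a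
  constant, and the multisets over \<open>F\<close> grow only polynomially, so dominated convergence applies to
  the sum over the weight \<open>j\<close> of the part in \<open>F\<close>.
\<close>

lemma card_msets_limit:
  assumes w: "\<And>a. a \<in> E \<Longrightarrow> 1 \<le> w a"
    and fin: "\<And>n. finite (msets E w n)" and pos: "\<And>n. card (msets E w n) > 0"
    and lim: "(\<lambda>n. real (card (msets E w n)) / real (card (msets E w (n + 1)))) \<longlonglongrightarrow> \<rho>"
    and "\<rho> < 1" and F: "finite F" "F \<subseteq> E"
    and PQ: "\<And>M. set_mset M \<subseteq> E \<Longrightarrow> {#a \<in># M. a \<notin> F#} \<noteq> {#} \<Longrightarrow> P M \<longleftrightarrow> Q {#a \<in># M. a \<in> F#}"
  shows "\<exists>l. (\<lambda>n. real (card {M \<in> msets E w n. P M}) / real (card (msets E w n))) \<longlonglongrightarrow> l"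
proof -
  define c where "c n = real (card (msets E w n))" for n
  define h where "h n = real (card (msets (E - F) w n - {{#}}))" for n
  define d where "d n = real (card {L \<in> msets F w n. Q L})" for n
  define e where "e n = real (card {L \<in> msets F w n. P L})" for n
  have cpos: "c n > 0" for n
    using pos by (simp add: c_def)
  have clim: "(\<lambda>n. c n / c (n + 1)) \<longlonglongrightarrow> \<rho>"
    using lim by (simp add: c_def)
  obtain r C where r: "0 < r" "r < 1" "0 \<le> C"
      and bound: "\<And>n j. j \<le> n \<Longrightarrow> c (n - j) \<le> C * r ^ j * c n"
    using ratio_geometric_bound[OF cpos clim assms(5)] by blast
  have finF: "finite (msets F w n)" "finite (msets (E - F) w n)" for n
    using finite_msets_mono[OF fin] F(2) by auto
  have poly: "d n \<le> (real n + 1) ^ card F" "e n \<le> (real n + 1) ^ card F" for n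
  proof -
    have "card (msets F w n) \<le> (n + 1) ^ card F"
      using F w by (intro card_msets_finite_le) auto
    then have *: "real (card (msets F w n)) \<le> (real n + 1) ^ card F"
      by (metis of_nat_le_iff of_nat_power of_nat_add of_nat_1)
    have "d n \<le> real (card (msets F w n))" "e n \<le> real (card (msets F w n))"
      unfolding d_def e_def using finF(1) by (auto intro!: card_mono)
    with * show "d n \<le> (real n + 1) ^ card F" "e n \<le> (real n + 1) ^ card F" by linarith+
  qed
  define B where "B n = (real n + 1) ^ card F * (C * r ^ n)" for n
  have "B = (\<lambda>n. C * ((real n + 1) ^ card F * r ^ n))"
    by (simp add: B_def fun_eq_iff)
  then have B: "summable B"
    using summable_mult[OF summable_poly_times_power[OF r(1,2), of "card F"], of C] by simp
  have hc: "h n \<le> c n" for n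
    unfolding h_def c_def of_nat_le_iff by (intro card_mono fin) (auto simp: msets_def)

  have "(\<lambda>n. e n / c n) \<longlonglongrightarrow> 0"
  proof (rule Lim_null_comparison[OF _ summable_LIMSEQ_zero[OF B]])
    have "norm (e n / c n) \<le> B n" for n
    proof -
      \<comment> \<open>The geometric bound with \<open>j = n\<close> shows that \<open>c n\<close>
        grows at least like \<open>r ^ (-n)\<close>, faster than the polynomial bound on
        \<open>e n\<close>.\<close>
      have "1 \<le> c 0"
        using pos[of 0] by (simp add: c_def)
      also have "\<dots> \<le> C * r ^ n * c n"
        using bound[of n n] by simp
      finally have "1 / c n \<le> C * r ^ n"
        using cpos[of n] by (simp add: field_simps)
      then have "e n * (1 / c n) \<le> B n"
        unfolding B_def using poly(2) cpos[of n] r by (intro mult_mono) auto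
      then show ?thesis
        using cpos[of n] by (simp add: e_def)
    qed
    then show "eventually (\<lambda>n. norm (e n / c n) \<le> B n) sequentially"
      by simp
  qed
  moreover have "\<exists>s. (\<lambda>n. (\<Sum>j\<le>n. d j * h (n - j)) / c n) \<longlonglongrightarrow> s"
  proof -
    obtain K where "(\<lambda>n. real (card (msets (E - F) w n)) / c n) \<longlonglongrightarrow> K"
      using convergent_card_msets_ratio[OF fin pos lim F] by (auto simp: c_def)
    \<comment> \<open>The empty multiset has weight 0, so excluding it changes only the value at
      \<open>n = 0\<close>.\<close>
    moreover have "eventually (\<lambda>n. real (card (msets (E - F) w n)) / c n = h n / c n) sequentially"
    proof (rule eventually_mono[OF eventually_gt_at_top[of 0]])
      fix n :: nat assume "0 < n"
      then have "{#} \<notin> msets (E - F) w n"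
        by (auto simp: msets_def)
      then show "real (card (msets (E - F) w n)) / c n = h n / c n"
        by (simp add: h_def)
    qed
    ultimately have K: "(\<lambda>n. h n / c n) \<longlonglongrightarrow> K"
      by (rule Lim_transform_eventually)
    \<comment> \<open>Extending by zero turns the finite convolution into a series over all
      \<open>j\<close>, with majorant \<open>B\<close> independent of \<open>n\<close>, as Tannery's
      theorem demands.\<close>
    define a where "a j n = (if j \<le> n then d j * h (n - j) / c n else 0)" for j n
    have a_lim: "(\<lambda>n. a j n) \<longlonglongrightarrow> d j * (K * \<rho> ^ j)" for j
    proof (rule LIMSEQ_offset[of _ j])
      have "(\<lambda>n. d j * (h n / c n * (c n / c (n + j)))) \<longlonglongrightarrow> d j * (K * \<rho> ^ j)"
        using LIMSEQ_ignore_initial_segment[OF tendsto_shifted_ratio[OF cpos clim], of j j]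
        by (intro tendsto_mult tendsto_const K) simp
      moreover have "d j * (h n / c n * (c n / c (n + j))) = a j (n + j)" for n
        using cpos[of n] by (simp add: a_def)
      ultimately show "(\<lambda>n. a j (n + j)) \<longlonglongrightarrow> d j * (K * \<rho> ^ j)"
        by simp
    qed
    have "norm (a j n) \<le> B j" for j n
    proof (cases "j \<le> n")
      case True
      have "h (n - j) / c n \<le> C * r ^ j"
        using order_trans[OF hc bound[OF True]] cpos[of n] by (simp add: field_simps)
      then have "d j * (h (n - j) / c n) \<le> B j"
        unfolding B_def using poly(1) cpos[of n] by (intro mult_mono) (auto simp: h_def)
      then show ?thesis
        using True cpos[of n] by (simp add: a_def d_def h_def)
    qed (use r in \<open>simp add: a_def B_def\<close>)
    then have "eventually (\<lambda>(j, n). norm (a j n) \<le> B j) (at_top \<times>\<^sub>F sequentially)"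
      by (intro always_eventually) auto
    from tannerys_theorem[OF a_lim this B sequentially_bot]
    have "(\<lambda>n. suminf (\<lambda>j. a j n)) \<longlonglongrightarrow> (\<Sum>j. d j * (K * \<rho> ^ j))"
      by (elim conjE)
    moreover have "suminf (\<lambda>j. a j n) = (\<Sum>j\<le>n. d j * h (n - j)) / c n" for n
    proof -
      have "suminf (\<lambda>j. a j n) = (\<Sum>j\<le>n. a j n)"
        by (rule suminf_finite) (auto simp: a_def)
      then show ?thesis
        by (simp add: a_def sum_divide_distrib)
    qed
    ultimately show ?thesis by auto
  qed
  then obtain s where "(\<lambda>n. (\<Sum>j\<le>n. d j * h (n - j)) / c n) \<longlonglongrightarrow> s" ..
  ultimately have "(\<lambda>n. e n / c n + (\<Sum>j\<le>n. d j * h (n - j)) / c n) \<longlonglongrightarrow> 0 + s"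
    by (rule tendsto_add)
  moreover have "card {M \<in> msets E w n. P M} = card {M \<in> msets F w n. P M} +
      (\<Sum>j\<le>n. card {L \<in> msets F w j. Q L} * card (msets (E - F) w (n - j) - {{#}}))" for n
    using fin F(2) PQ by (rule card_msets_split)
  then have "real (card {M \<in> msets E w n. P M}) = e n + (\<Sum>j\<le>n. d j * h (n - j))" for n
    by (simp only: e_def d_def h_def of_nat_add of_nat_sum of_nat_mult)
  ultimately show ?thesis
    by (auto simp: c_def add_divide_distrib)
qed

section \<open>The limit law\<close>

lemma standard_norm_0:
  assumes "standard_norm (0 :: 'a::infinite ordinal) m"
  shows "m = 0"
  using assms
proof cases
  case (1 as ms)
  then have "as = []"
    using omega_sum_inject[of as "[]"] by (simp add: nonincreasing_def)
  with 1 show ?thesis by simp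
qed

text \<open>Uniqueness of the normal form identifies the list as \<open>[0]\<close>, so the value is
  one plus the norm of 0.\<close>

lemma standard_norm_1:
  assumes "standard_norm (1 :: 'a::infinite ordinal) m"
  shows "m = 1"
  using assms
proof cases
  case (1 as ms)
  then have "as = [0]"
    using omega_sum_inject[of as "[0]"] by (simp add: nonincreasing_def)
  with 1 obtain m' where "ms = [m']" "standard_norm (0 :: 'a ordinal) m'"
    by (auto simp: list_all2_Cons1)
  with 1 \<open>as = [0]\<close> show ?thesis
    using standard_norm_0 by auto
qed

section \<open>Translation between ordinals and multisets\<close>

lemma mset_ordinal_less_iff:
  "mset_ordinal M < omega_pow c \<longleftrightarrow> set_mset M \<subseteq> {..<c :: 'a::infinite ordinal}"
  unfolding mset_ordinal_def less_omega_pow_iff_cnf cnf_omega_sum[OF nonincreasing_rev_sorted_list]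
  by auto

lemma bij_mset_ordinal: "bij (mset_ordinal :: 'a::infinite ordinal multiset \<Rightarrow> 'a ordinal)"
proof (rule o_bij)
  show "(\<lambda>a. mset (cnf a)) \<circ> mset_ordinal = (id :: 'a ordinal multiset \<Rightarrow> _)"
    by (simp add: fun_eq_iff mset_ordinal_def cnf_omega_sum[OF nonincreasing_rev_sorted_list])
  have "rev (sort (cnf a)) = cnf a" for a :: "'a ordinal"
  proof -
    have "sort (cnf a) = rev (cnf a)"
      using cnf_props(1)[of a] by (intro properties_for_sort) (auto simp: nonincreasing_iff_sorted_rev)
    then show ?thesis by simp
  qed
  then show "mset_ordinal \<circ> (\<lambda>a. mset (cnf a)) = (id :: 'a ordinal \<Rightarrow> _)"
    by (simp add: fun_eq_iff mset_ordinal_def cnf_props)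
qed

lemma norm_mset_ordinal:
  assumes "additive_number_system \<gamma> N" "set_mset M \<subseteq> {..<\<gamma>}"
  shows "N (mset_ordinal M) = weight (\<lambda>a. N (omega_pow a)) M"
proof -
  let ?as = "rev (sorted_list_of_multiset M)"
  have "N (foldr (\<oplus>) (map omega_pow ?as) 0) = sum_list (map (\<lambda>a. N (omega_pow a)) ?as)"
    using assms nonincreasing_rev_sorted_list[of M] unfolding additive_number_system_def by force
  also have "\<dots> = weight (\<lambda>a. N (omega_pow a)) M"
    unfolding weight_def by (simp flip: sum_mset_sum_list)
  finally show ?thesis
    by (simp only: mset_ordinal_def foldr_natural_sum[OF nonincreasing_rev_sorted_list])
qed

lemma finite_lessThan_fin_ord: "finite {..<fin_ord p :: 'a::infinite ordinal}"
proof -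
  have "{..<fin_ord p :: 'a ordinal} = fin_ord ` {..<p}"
    by (auto simp: less_fin_ord_iff)
  then show ?thesis by simp
qed

theorem mainTheorem4:
  fixes \<beta> \<gamma> :: "'a::infinite ordinal"
    and N :: "'a ordinal \<Rightarrow> nat"
    and \<rho> :: real
  assumes "\<beta> = omega_pow \<gamma>"
    and "\<beta> \<ge> epsilon0"
    and "additive_number_system \<gamma> N"
    and "extends_standard_norm N"
    and "RT \<rho> (norm_count N \<beta>)"
    and "\<rho> < 1"
  shows "mso_limit_law \<beta> N"
  unfolding mso_limit_law_def
proof (intro allI impI)
  fix f assume f: "sentence f"
  define w where "w a = N (omega_pow a)" for a
  let ?E = "{..<\<gamma>}"
  have fin: "finite {a. a < \<beta> \<and> N a = n}" and w: "a < \<gamma> \<Longrightarrow> 1 \<le> w a" for n a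
    using assms(1,3) by (auto simp: additive_number_system_def w_def)
  \<comment> \<open>The property \<open>R\<close> is arbitrary, so that numerator and denominator
    are translated into multiset counts by the same fact.\<close>
  have image: "mset_ordinal ` {M \<in> msets ?E w n. R (mset_ordinal M)} = {a. a < \<beta> \<and> R a \<and> N a = n}" for n R
  proof (intro equalityI subsetI)
    fix a assume a: "a \<in> {a. a < \<beta> \<and> R a \<and> N a = n}"
    obtain M where M: "a = mset_ordinal M"
      using bij_mset_ordinal by (metis bij_pointE)
    with a have "set_mset M \<subseteq> ?E"
      by (simp add: assms(1) mset_ordinal_less_iff)
    with a M show "a \<in> mset_ordinal ` {M \<in> msets ?E w n. R (mset_ordinal M)}"
      using norm_mset_ordinal[OF assms(3)] by (auto simp: msets_def w_def[abs_def])
  qed (use norm_mset_ordinal[OF assms(3)] in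
      \<open>auto simp: msets_def w_def[abs_def] assms(1) mset_ordinal_less_iff\<close>)
  have inj: "inj_on mset_ordinal A" for A :: "'a ordinal multiset set"
    using bij_mset_ordinal by (meson bij_is_inj inj_on_subset subset_UNIV)
  have card: "card {a. a < \<beta> \<and> R a \<and> N a = n} = card {M \<in> msets ?E w n. R (mset_ordinal M)}" for n R
    unfolding image[symmetric] by (rule card_image[OF inj])
  have count: "norm_count N \<beta> n = card (msets ?E w n)" for n
    using card[of "\<lambda>_. True" n] by (simp add: norm_count_def)
  have fin_msets: "finite (msets ?E w n)" for n
  proof -
    have "mset_ordinal ` msets ?E w n = {a. a < \<beta> \<and> N a = n}"
      using image[of n "\<lambda>_. True"] by simp
    then show ?thesis
      using fin[of n] finite_imageD[OF _ inj] by metis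
  qed

  have "1 < \<beta>"
    using assms(2) one_less_epsilon0 by (rule less_le_trans[rotated])
  then have "0 < \<gamma>"
    using omega_pow_less_iff[of 0 \<gamma>] by (simp only: assms(1) omega_pow_0)
  \<comment> \<open>A prime of weight one: \<open>n\<close> copies of the exponent 0 have weight
    \<open>n\<close>, so every count is positive.\<close>
  have "w 0 = 1"
    using assms(4) one_less_epsilon0 standard_norm_1
    by (auto simp: w_def extends_standard_norm_def)
  then have "weight w (replicate_mset n 0) = n" for n
    by (induction n) simp_all
  then have "replicate_mset n 0 \<in> msets ?E w n" for n
    using \<open>0 < \<gamma>\<close> by (auto simp: msets_def)
  then have pos: "card (msets ?E w n) > 0" for n
    using fin_msets[of n] card_gt_0_iff by blast

  have "{..<\<beta>} = (\<Union>n. {a. a < \<beta> \<and> N a = n})"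
    by auto
  also have "countable \<dots>"
    by (intro countable_UN countableI_type countable_finite[OF fin])
  finally have countable: "countable {..<a}" if "a < \<gamma>" for a
  proof (rule countable_subset[rotated])
    \<comment> \<open>From \<open>a \<le> omega_pow a < omega_pow \<gamma>\<close>, countability
      passes from \<open>\<beta>\<close> to the exponents.\<close>
    have "a < \<beta>"
      using that le_omega_pow[of a] omega_pow_strict_mono[OF that] assms(1) by (metis le_less_trans)
    then show "{..<a} \<subseteq> {..<\<beta>}"
      by (simp add: less_imp_le)
  qed

  obtain p where p: "ord_equiv (mso_vars f) (mso_depth f)
      (omega_pow (fin_ord p)) (omega_pow (ord_succ (fin_ord p)) :: 'a ordinal)"
    using ex_omega_pow_equiv_succ[OF finite_mso_vars[of f], of "mso_depth f"] by auto
  let ?p = "fin_ord p :: 'a ordinal"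
  let ?F = "{a. a < \<gamma> \<and> a < ?p}"
  \<comment> \<open>The summand \<open>omega_pow ?p\<close> stands for an arbitrary nonempty high
    part, all of which are equivalent to it at this depth.\<close>
  let ?Q = "\<lambda>L. omega_pow ?p + mset_ordinal L \<Turnstile> f"
  have "mset_ordinal M \<Turnstile> f \<longleftrightarrow> ?Q {#a \<in># M. a \<in> ?F#}"
    if M: "set_mset M \<subseteq> ?E" "{#a \<in># M. a \<notin> ?F#} \<noteq> {#}" for M
  proof -
    have F: "{#a \<in># M. a \<in> ?F#} = {#a \<in># M. a < ?p#}" "{#a \<in># M. a \<notin> ?F#} = {#a \<in># M. \<not> a < ?p#}"
      using M(1) by (auto intro!: filter_mset_cong)
    have "ord_equiv (mso_vars f) (mso_depth f) (mset_ordinal M)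
        (omega_pow ?p + mset_ordinal {#a \<in># M. a < ?p#})"
      by (rule mset_ordinal_equiv[OF p]) (use M countable F(2) in auto)
    then show ?thesis
      unfolding F(1) using f by (rule models_ord_equiv)
  qed
  moreover have "finite ?F"
    by (rule finite_subset[OF _ finite_lessThan_fin_ord[of p]]) auto
  moreover have "(\<lambda>n. real (card (msets ?E w n)) / real (card (msets ?E w (n + 1)))) \<longlonglongrightarrow> \<rho>"
    using assms(5) by (simp add: RT_def count)
  ultimately have "\<exists>l. (\<lambda>n. real (card {M \<in> msets ?E w n. mset_ordinal M \<Turnstile> f}) /
      real (card (msets ?E w n))) \<longlonglongrightarrow> l"
    using w fin_msets pos assms(6) by (intro card_msets_limit[where F = ?F and Q = ?Q]) auto
  then show "\<exists>l. (\<lambda>n. real (card {a. a < \<beta> \<and> a \<Turnstile> f \<and> N a = n}) / real (norm_count N \<beta> n))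
      \<longlonglongrightarrow> l"
    by (simp add: card[of "\<lambda>a. a \<Turnstile> f"] count)
qed

end
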